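(* Consider a continuous-time controlled Markov system $\{S,B,(A(i)\subset A: i\in S),q(j|i,a)\}$ satisfying the standing assumptions listed in the context, and let $h^*_i=\inf_{\pi\in\Pi_m}h^\pi_i$ for $i\in B^c:=S\setminus B$ be the minimal hitting probability of $B$. (i) The family $(h^*_i : i\in B^c)$ satisfies the optimality equation $$x_i=\min_{a\in A(i)}\Big\{\frac{1}{q_i(a)}\Big[\sum_{k\in B}q(k|i,a)+\sum_{k\in B^c\setminus\{i\}}q(k|i,a)\,x_k\Big]\Big\},\qquad i\in B^c.$$ (ii) There exists a deterministic stationary policy $f^*\in F$ such that $$f^*(i)\in\mathop{\arg\min}_{a\in A(i)}\Big\{\frac{1}{q_i(a)}\Big[\sum_{k\in B}q(k|i,a)+\sum_{k\in B^c\setminus\{i\}}q(k|i,a)\,h^*_k\Big]\Big\},\qquad i\in B^c,$$ and $f^*$ is optimal, i.e. $h^{f^*}_i=h^*_i$ for all $i\in B^c$.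
   Context: Model. $S$ is a countable state space; $B\subset S$ is a given finite target set; for each $i\in S$, $A(i)$ is a finite (nonempty) set of admissible actions, and $A=\bigcup_{i\in S}A(i)$. Let $\mathbf K=\{(i,a): i\in S, a\in A(i)\}$. The transition rates $q(j|i,a)$ satisfy $q(j|i,a)\ge 0$ for $(i,a)\in\mathbf K$, $j\ne i$; they are conservative, $\sum_{j\in S}q(j|i,a)=0$ for all $(i,a)\in\mathbf K$; and stable, $q^*(i):=\max_{a\in A(i)}q_i(a)<\infty$ for all $i\in S$, where $q_i(a):=-q(i|i,a)$. Standing assumptions. (a) $q_i(a)>0$ for all $i\in B^c$ and $a\in A(i)$. (b) $B$ is absorbing under all policies (once the process enters $B$ it stays in $B$; that is, $q(j|i,a)=0$ for $i\in B$, $j\notin B$, $a\in A(i)$). (c) There exist a function $R\ge 1$ on $S$ and constants $c_0\neq 0$, $b_0\ge 0$, $L_0>0$ such that $\sum_{j\in S}q(j|i,a)R(j)\le c_0R(i)+b_0$ for all $(i,a)\in\mathbf K$, and $q^*(i)\le L_0R(i)$ for all $i\in S$. (This guarantees that the transition functions below are unique and honest, i.e. the process does not explode.) Policies. A randomized Markov policy $\pi=\{\pi_t:t\ge0\}$ is a family $\pi_t(C|i)$ such that for all $i\in S$ and measurable $C\subset A(i)$ the map $t\mapsto\pi_t(C|i)$ is measurable on $[0,\infty)$, and for all $i\in S$, $t\ge0$, $\pi_t(\cdot|i)$ is a probability measure on $A$ with $\pi_t(A(i)|i)=1$. $\Pi_m$ is the set of all randomized Markov policies. A deterministic stationary policy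 is a map $f:S\to A$ with $f(i)\in A(i)$ for all $i$, identified with the policy with $\pi_t(\{f(i)\}|i)\equiv1$; $F\subset\Pi_m$ is the set of these. Process and hitting probability. For $\pi\in\Pi_m$ put $q(j|i,\pi_t)=\sum_{a\in A(i)}q(j|i,a)\pi_t(a|i)$. Let $X=\{X(t):t\ge0\}$ be the (in general time-inhomogeneous) continuous-time Markov jump process on $S$ with transition rates $q(j|i,\pi_t)$ at time $t$, and let $P^\pi_{i,0}$ be the law under which $X(0)=i$. Let $\tau_B=\inf\{t\ge0: X(t)\in B\}$ (with $\inf\emptyset=\infty$) and $h^\pi_i=P^\pi_{i,0}(\tau_B<\infty)$. A policy $\pi^*\in\Pi_m$ is optimal if $h^{\pi^*}_i=h^*_i$ for all $i\in B^c$, where $h^*_i:=\inf_{\pi\in\Pi_m}h^\pi_i$. *)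

theory Defs
  imports "HOL-Probability.Probability"
begin

section \<open>Controlled systems\<close>

text \<open>
  The countable state space \<open>S\<close> is the type \<open>'s\<close>, and \<open>q j i a\<close> stands for the rate \<open>q(j|i,a)\<close>
  of a transition from \<open>i\<close> to \<open>j\<close>.
\<close>

definition exit_rate :: "('s \<Rightarrow> 's \<Rightarrow> 'a \<Rightarrow> real) \<Rightarrow> 's \<Rightarrow> 'a \<Rightarrow> real" where
  "exit_rate q i a = - q i i a"

definition max_exit_rate :: "('s \<Rightarrow> 'a set) \<Rightarrow> ('s \<Rightarrow> 's \<Rightarrow> 'a \<Rightarrow> real) \<Rightarrow> 's \<Rightarrow> real" where
  "max_exit_rate A q i = Max (exit_rate q i ` A i)"

text \<open>
  Stability, i.e. finiteness of the maximal exit rate, needs no assumption: the rates are real and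
  every \<open>A i\<close> is finite. In the drift condition the summability clause says that the sum of the
  series, which has at most one negative term, is finite.
\<close>

locale controlled_system =
  fixes B :: "'s::countable set"
    and A :: "'s \<Rightarrow> 'a set"
    and q :: "'s \<Rightarrow> 's \<Rightarrow> 'a \<Rightarrow> real"
  assumes finite_target: "finite B"
    and finite_actions: "finite (A i)"
    and actions_nonempty: "A i \<noteq> {}"
    and rate_nonneg: "a \<in> A i \<Longrightarrow> j \<noteq> i \<Longrightarrow> 0 \<le> q j i a"
    and conservative: "a \<in> A i \<Longrightarrow> ((\<lambda>j. q j i a) has_sum 0) UNIV"
    and exit_rate_pos: "i \<notin> B \<Longrightarrow> a \<in> A i \<Longrightarrow> 0 < exit_rate q i a"
    and absorbing: "i \<in> B \<Longrightarrow> j \<notin> B \<Longrightarrow> a \<in> A i \<Longrightarrow> q j i a = 0"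
    and drift: "\<exists>(R :: 's \<Rightarrow> real) c\<^sub>0 b\<^sub>0 L\<^sub>0.
          (\<forall>i. 1 \<le> R i) \<and> c\<^sub>0 \<noteq> 0 \<and> 0 \<le> b\<^sub>0 \<and> 0 < L\<^sub>0 \<and>
          (\<forall>i. \<forall>a\<in>A i. (\<lambda>j. q j i a * R j) summable_on UNIV \<and>
                       (\<Sum>\<^sub>\<infinity>j. q j i a * R j) \<le> c\<^sub>0 * R i + b\<^sub>0) \<and>
          (\<forall>i. max_exit_rate A q i \<le> L\<^sub>0 * R i)"


section \<open>Policies\<close>

text \<open>
  Since every \<open>A i\<close> is finite, the probability measures concentrated on \<open>A i\<close> are
  probability mass functions and every subset of \<open>A i\<close> is measurable. Only the values of a policy
  at times \<open>t \<ge> 0\<close> matter.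
\<close>

type_synonym ('s, 'a) policy = "real \<Rightarrow> 's \<Rightarrow> 'a pmf"

definition markov_policies :: "('s \<Rightarrow> 'a set) \<Rightarrow> ('s, 'a) policy set" where
  "markov_policies A = {\<pi>.
     (\<forall>i C. C \<subseteq> A i \<longrightarrow>
        (\<lambda>t. measure_pmf.prob (\<pi> t i) C) \<in> borel_measurable (restrict_space borel {0..})) \<and>
     (\<forall>t\<ge>0. \<forall>i. measure_pmf.prob (\<pi> t i) (A i) = 1)}"

definition decision_functions :: "('s \<Rightarrow> 'a set) \<Rightarrow> ('s \<Rightarrow> 'a) set" where
  "decision_functions A = {f. \<forall>i. f i \<in> A i}"

definition stationary_policy :: "('s \<Rightarrow> 'a) \<Rightarrow> ('s, 'a) policy" where
  "stationary_policy f = (\<lambda>t i. return_pmf (f i))"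

definition policy_rate ::
  "('s \<Rightarrow> 'a set) \<Rightarrow> ('s \<Rightarrow> 's \<Rightarrow> 'a \<Rightarrow> real) \<Rightarrow> ('s, 'a) policy \<Rightarrow> 's \<Rightarrow> 's \<Rightarrow> real \<Rightarrow> real" where
  "policy_rate A q \<pi> j i t = (\<Sum>a\<in>A i. q j i a * pmf (\<pi> t i) a)"


section \<open>The jump process\<close>

text \<open>
  For a family of (time dependent) rates \<open>r j i t\<close>, the Markov jump process is constructed from its
  sequence of jump times and post-jump states. Given that state \<open>i\<close> is entered at time \<open>s\<close>, the next
  jump happens in \<open>dt\<close> and leads to \<open>j \<noteq> i\<close> with probability
  \<open>r j i t * exp (- \<integral>\<^sub>s\<^sup>t (- r i i u) du) dt\<close>. Jump times are extended nonnegative reals: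
  with the remaining probability there is no further jump, which is encoded by the pair
  \<open>(\<infinity>, i)\<close>. The measure \<open>finite_jump_law\<close> is the part of this law on finite jump times. For
  \<open>s = \<infinity>\<close> it is zero.
\<close>

abbreviation jump_space :: "(ennreal \<times> 's) measure" where
  "jump_space \<equiv> borel \<Otimes>\<^sub>M count_space UNIV"

definition jump_density :: "('s \<Rightarrow> 's \<Rightarrow> real \<Rightarrow> real) \<Rightarrow> ennreal \<times> 's \<Rightarrow> real \<times> 's \<Rightarrow> ennreal" where
  "jump_density r = (\<lambda>(s, i) (t, j).
     if s < ennreal t \<and> j \<noteq> i
     then ennreal (r j i t * exp (- (LINT u:{enn2real s..t}|lborel. - r i i u)))
     else 0)"

definition finite_jump_law ::
  "('s \<Rightarrow> 's \<Rightarrow> real \<Rightarrow> real) \<Rightarrow> ennreal \<times> 's \<Rightarrow> (ennreal \<times> 's) measure" where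
  "finite_jump_law r x =
     distr (density (lborel \<Otimes>\<^sub>M count_space UNIV) (jump_density r x)) jump_space
       (\<lambda>(t, j). (ennreal t, j))"

definition jump_kernel ::
  "('s \<Rightarrow> 's \<Rightarrow> real \<Rightarrow> real) \<Rightarrow> ennreal \<times> 's \<Rightarrow> (ennreal \<times> 's) measure" where
  "jump_kernel r x = measure_of UNIV (sets jump_space)
     (\<lambda>E. emeasure (finite_jump_law r x) E +
          (1 - emeasure (finite_jump_law r x) UNIV) * indicator E (\<infinity>, snd x))"

text \<open>
  The law of the jump sequence, starting in \<open>i\<close> at time 0: component \<open>n\<close> consists of the time of
  the \<open>n\<close>-th jump and the state entered then.
\<close>

primrec jump_step ::
  "('s \<Rightarrow> 's \<Rightarrow> real \<Rightarrow> real) \<Rightarrow> 's \<Rightarrow> nat \<Rightarrow> (nat \<Rightarrow> ennreal \<times> 's) \<Rightarrow> (ennreal \<times> 's) measure" where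
  "jump_step r i 0 = (\<lambda>\<omega>. return jump_space (0, i))"
| "jump_step r i (Suc n) = (\<lambda>\<omega>. jump_kernel r (\<omega> n))"

definition jump_law ::
  "('s \<Rightarrow> 's \<Rightarrow> real \<Rightarrow> real) \<Rightarrow> 's \<Rightarrow> (nat \<Rightarrow> ennreal \<times> 's) measure" where
  "jump_law r i = projective_family.lim UNIV
     (Ionescu_Tulcea.CI (jump_step r i) (\<lambda>_. jump_space)) (\<lambda>_. jump_space)"

text \<open>
  The state \<open>X(t)\<close>. The value \<open>None\<close> is a cemetery, attained at and after the accumulation point of
  the jump times; by the drift condition a
  controlled system attains it with probability 0 only.
\<close>

definition state_at :: "(nat \<Rightarrow> ennreal \<times> 's) \<Rightarrow> real \<Rightarrow> 's option" where
  "state_at \<omega> t =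
     (let current = (\<lambda>n. fst (\<omega> n) \<le> ennreal t \<and> ennreal t < fst (\<omega> (Suc n)))
      in if \<exists>n. current n then Some (snd (\<omega> (LEAST n. current n))) else None)"

definition hitting_time :: "'s set \<Rightarrow> (nat \<Rightarrow> ennreal \<times> 's) \<Rightarrow> ennreal" where
  "hitting_time B \<omega> = Inf {ennreal t | t. 0 \<le> t \<and> state_at \<omega> t \<in> Some ` B}"


section \<open>Hitting probabilities\<close>

definition policy_law ::
  "('s \<Rightarrow> 'a set) \<Rightarrow> ('s \<Rightarrow> 's \<Rightarrow> 'a \<Rightarrow> real) \<Rightarrow> ('s, 'a) policy \<Rightarrow> 's \<Rightarrow> (nat \<Rightarrow> ennreal \<times> 's) measure"
  where "policy_law A q \<pi> i = jump_law (policy_rate A q \<pi>) i"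

definition hit_prob ::
  "'s set \<Rightarrow> ('s \<Rightarrow> 'a set) \<Rightarrow> ('s \<Rightarrow> 's \<Rightarrow> 'a \<Rightarrow> real) \<Rightarrow> ('s, 'a) policy \<Rightarrow> 's \<Rightarrow> real" where
  "hit_prob B A q \<pi> i =
     measure (policy_law A q \<pi> i) {\<omega> \<in> space (policy_law A q \<pi> i). hitting_time B \<omega> < \<infinity>}"

definition min_hit_prob ::
  "'s set \<Rightarrow> ('s \<Rightarrow> 'a set) \<Rightarrow> ('s \<Rightarrow> 's \<Rightarrow> 'a \<Rightarrow> real) \<Rightarrow> 's \<Rightarrow> real" where
  "min_hit_prob B A q i = (INF \<pi>\<in>markov_policies A. hit_prob B A q \<pi> i)"

definition optimal_policy ::
  "'s set \<Rightarrow> ('s \<Rightarrow> 'a set) \<Rightarrow> ('s \<Rightarrow> 's \<Rightarrow> 'a \<Rightarrow> real) \<Rightarrow> ('s, 'a) policy \<Rightarrow> bool" where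
  "optimal_policy B A q \<pi> \<longleftrightarrow>
     \<pi> \<in> markov_policies A \<and> (\<forall>i\<in>-B. hit_prob B A q \<pi> i = min_hit_prob B A q i)"

text \<open>The expression minimized over \<open>a\<close> in the optimality equation.\<close>

definition one_step_value ::
  "'s set \<Rightarrow> ('s \<Rightarrow> 's \<Rightarrow> 'a \<Rightarrow> real) \<Rightarrow> ('s \<Rightarrow> real) \<Rightarrow> 's \<Rightarrow> 'a \<Rightarrow> real" where
  "one_step_value B q x i a =
     (1 / exit_rate q i a) * ((\<Sum>k\<in>B. q k i a) + (\<Sum>\<^sub>\<infinity>k\<in>-B - {i}. q k i a * x k))"

end

theory Submission
  imports Defs
begin

text \<open>
  Along almost every path the jump times increase strictly as long as they are finite, and a state
  other than the present one is entered at finite times only. Hence the process hits \<open>B\<close> if and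
  only if some entry of the jump sequence lies in \<open>B\<close> (lemma \<open>regular_path_hits_iff\<close>), and the
  hitting probability is the limit of the probabilities \<open>hit_within\<close> of reaching \<open>B\<close> within \<open>n\<close>
  jumps. These satisfy a backward recursion along the jump kernel (lemma \<open>hit_or_continue\<close>).

  Outside \<open>B\<close> the exit rate of any Markov policy is bounded away from \<open>0\<close>, so the next jump
  happens after a finite time with probability \<open>1\<close>. At a jump time \<open>t\<close> out of \<open>i\<close>, the new state is
  distributed according to a mixture over \<open>a\<close> of the laws \<open>q(j|i,a) / q_i(a)\<close>, with weights
  proportional to \<open>q_i(a) \<pi>\<^sub>t(a|i)\<close>. The continuous-time problem thus has the same one-step
  bounds as the discrete-time problem with these transition laws.

  That problem is solved by value iteration: start from the indicator of \<open>B\<close> and let every step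
  minimize the expected value after one jump. The iterates increase to a function \<open>v\<close>, and since
  the action sets are finite, the minimum commutes with the limit, so \<open>v\<close> solves the optimality
  equation (lemma \<open>optimal_action_exists\<close>). A mixture is at least the minimum, so induction on the
  number of jumps bounds the hitting probability of every Markov policy from below by \<open>v\<close>. For
  a decision function that attains the minimum at \<open>v\<close>, the same induction with \<open>v\<close> itself as a
  bound shows that every \<open>hit_within\<close> is at most \<open>v\<close>. Therefore \<open>v\<close> is the minimal hitting
  probability, and it is attained by this decision function.
\<close>

section \<open>Waiting times with a measurable hazard rate\<close>

lemma borel_measurable_integral_Icc[measurable (raw)]:
  fixes g :: "real \<Rightarrow> real"
  assumes [measurable]: "g \<in> borel_measurable borel" "a \<in> borel_measurable M" "b \<in> borel_measurable M"
  shows "(\<lambda>x. LINT u:{a x..b x}|lborel. g u) \<in> borel_measurable M"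
  unfolding set_lebesgue_integral_def
proof (rule sigma_finite_measure.borel_measurable_lebesgue_integral)
  have "(\<lambda>(x, u). indicator {a x..b x} u *\<^sub>R g u) = (\<lambda>(x, u). if a x \<le> u \<and> u \<le> b x then g u else 0)"
    by (auto simp: fun_eq_iff indicator_def)
  also have "\<dots> \<in> borel_measurable (M \<Otimes>\<^sub>M lborel)" by measurable
  finally show "(\<lambda>(x, u). indicator {a x..b x} u *\<^sub>R g u) \<in> borel_measurable (M \<Otimes>\<^sub>M lborel)" .
qed (rule lborel.sigma_finite_measure_axioms)

lemma set_integral_Icc_add:
  fixes g :: "real \<Rightarrow> real"
  assumes "a \<le> b" "b \<le> d" and int: "\<And>x y. set_integrable lborel {x..y} g"
  shows "(LINT u:{a..d}|lborel. g u) = (LINT u:{a..b}|lborel. g u) + (LINT u:{b..d}|lborel. g u)"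
proof -
  have "(LINT u:{a..b} \<union> {b..d}|lborel. g u) = (LINT u:{a..b}|lborel. g u) + (LINT u:{b..d}|lborel. g u)"
  proof (rule set_integral_Un_AE)
    have "AE x in lborel. x \<noteq> b" by (rule AE_lborel_singleton)
    then show "AE x in lborel. \<not> (x \<in> {a..b} \<and> x \<in> {b..d})" by eventually_elim auto
  qed (use int in auto)
  moreover have "{a..b} \<union> {b..d} = {a..d}" using assms by auto
  ultimately show ?thesis by simp
qed

lemma set_integral_Icc_bounds:
  fixes g :: "real \<Rightarrow> real"
  assumes ab: "a \<le> b" and "\<And>x y. set_integrable lborel {x..y} g"
    and "\<And>u. u \<in> {a..b} \<Longrightarrow> l \<le> g u" "\<And>u. u \<in> {a..b} \<Longrightarrow> g u \<le> m"
  shows "l * (b - a) \<le> (LINT u:{a..b}|lborel. g u)" "(LINT u:{a..b}|lborel. g u) \<le> m * (b - a)"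
proof -
  have const: "set_integrable lborel {a..b} (\<lambda>u. k)" "(LINT u:{a..b}|lborel. k) = k * (b - a)" for k :: real
    using ab by (auto simp: set_integrable_def set_lebesgue_integral_def)
  show "l * (b - a) \<le> (LINT u:{a..b}|lborel. g u)"
    unfolding const(2)[symmetric] by (rule set_integral_mono) (use assms const in auto)
  show "(LINT u:{a..b}|lborel. g u) \<le> m * (b - a)"
    unfolding const(2)[symmetric] by (rule set_integral_mono) (use assms const in auto)
qed

text \<open>
  The two errors made when \<open>1 - exp (- d)\<close> is replaced by \<open>d\<close> and by \<open>d * exp (- d)\<close>, the
  extreme values of the mass gained while the cumulated hazard grows by \<open>d\<close>. They make the
  increments in \<open>mass_balance_increment\<close> quadratically small.
\<close>

lemma exp_first_order_error:
  fixes d :: real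
  assumes "0 \<le> d"
  shows "exp (- d) - 1 + d \<le> d\<^sup>2" and "1 - exp (- d) - d * exp (- d) \<le> d\<^sup>2"
proof -
  have "(1 + d) * exp (- d) \<le> 1"
    using exp_ge_add_one_self[of d] by (simp add: exp_minus field_simps)
  then have "exp (- d) \<le> 1 / (1 + d)" using assms by (simp add: field_simps)
  also have "\<dots> \<le> 1 - d + d\<^sup>2" using assms by (simp add: field_simps power2_eq_square)
  finally show "exp (- d) - 1 + d \<le> d\<^sup>2" by simp
  have "(1 + d) * (1 - d) \<le> (1 + d) * exp (- d)"
    using exp_ge_add_one_self[of "-d"] assms by (intro mult_left_mono) auto
  then show "1 - exp (- d) - d * exp (- d) \<le> d\<^sup>2" by (simp add: algebra_simps power2_eq_square)
qed

text \<open>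
  Difference quotients of such a function are at most proportional to the step, so the derivative
  vanishes everywhere.
\<close>

lemma constant_if_quadratic_increments:
  fixes F :: "real \<Rightarrow> real"
  assumes "s \<le> t" and inc: "\<And>a b. s \<le> a \<Longrightarrow> a \<le> b \<Longrightarrow> \<bar>F b - F a\<bar> \<le> k * (b - a)\<^sup>2"
  shows "F t = F s"
proof -
  have inc': "\<bar>F b - F a\<bar> \<le> k * (b - a)\<^sup>2" if "a \<in> {s..}" "b \<in> {s..}" for a b
    using inc[of a b] inc[of b a] that by (cases "a \<le> b") (auto simp: power2_commute abs_minus_commute)
  have "(F has_field_derivative 0) (at x within {s..})" if x: "x \<in> {s..}" for x
    unfolding has_field_derivative_iff
  proof (rule Lim_null_comparison)
    have "eventually (\<lambda>y. y \<in> {s..} \<and> y \<noteq> x) (at x within {s..})"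
      by (auto simp: eventually_at_filter)
    then show "\<forall>\<^sub>F y in at x within {s..}. norm ((F y - F x) / (y - x)) \<le> k * \<bar>y - x\<bar>"
    proof eventually_elim
      case (elim y)
      then have "\<bar>F y - F x\<bar> \<le> (k * \<bar>y - x\<bar>) * \<bar>y - x\<bar>"
        using inc'[OF x, of y] by (simp add: power2_eq_square abs_mult[symmetric] mult.assoc)
      with elim show ?case by (simp add: divide_le_eq)
    qed
    have "((\<lambda>y. k * \<bar>y - x\<bar>) \<longlongrightarrow> k * \<bar>x - x\<bar>) (at x within {s..})"
      by (intro tendsto_intros)
    then show "((\<lambda>y. k * \<bar>y - x\<bar>) \<longlongrightarrow> 0) (at x within {s..})" by simp
  qed
  then have "\<exists>K. \<forall>x\<in>{s..}. F x = K"
    by (intro has_field_derivative_zero_constant) (auto simp: convex_real_interval)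
  with \<open>s \<le> t\<close> show ?thesis by force
qed

text \<open>
  A jump with hazard rate \<open>h\<close>, waited for from time \<open>s\<close> on. The rate is only measurable, so the
  cumulated hazard need not be differentiable everywhere, and \<open>- exp (- cumulated s t)\<close> need not be
  an antiderivative of the waiting density in the classical sense. The boundedness of \<open>h\<close> serves
  as a replacement for differentiability.
\<close>

locale hazard =
  fixes h :: "real \<Rightarrow> real" and c :: real
  assumes hazard_measurable[measurable]: "h \<in> borel_measurable borel"
    and hazard_nonneg: "0 \<le> h t"
    and hazard_le: "h t \<le> c"
begin

abbreviation cumulated :: "real \<Rightarrow> real \<Rightarrow> real" where
  "cumulated s t \<equiv> (LINT u:{s..t}|lborel. h u)"

abbreviation waiting_density :: "real \<Rightarrow> real \<Rightarrow> real" where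
  "waiting_density s t \<equiv> h t * exp (- cumulated s t)"

lemma bound_nonneg: "0 \<le> c"
  using hazard_nonneg[of 0] hazard_le[of 0] by simp

lemma hazard_set_integrable: "set_integrable lborel {s..t} h"
  unfolding set_integrable_def
  by (rule integrableI_bounded_set_indicator[where B=c])
     (auto simp: hazard_nonneg hazard_le emeasure_lborel_Icc_eq)

lemma cumulated_nonneg: "0 \<le> cumulated s t"
  unfolding set_lebesgue_integral_def
  by (intro integral_nonneg_AE AE_I2) (auto simp: hazard_nonneg)

lemma waiting_density_nonneg: "0 \<le> waiting_density s t"
  by (simp add: hazard_nonneg)

lemma waiting_density_le: "waiting_density s t \<le> c"
proof -
  have "waiting_density s t \<le> c * 1"
    using cumulated_nonneg bound_nonneg by (intro mult_mono hazard_le) auto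
  then show ?thesis by simp
qed

lemma waiting_density_set_integrable: "set_integrable lborel {a..b} (waiting_density s)"
  unfolding set_integrable_def
proof (rule integrableI_bounded_set_indicator[where B=c])
  show "waiting_density s \<in> borel_measurable lborel" by measurable
  show "AE x in lborel. x \<in> {a..b} \<longrightarrow> norm (waiting_density s x) \<le> c"
    using waiting_density_nonneg waiting_density_le by (auto simp: abs_mult hazard_nonneg)
qed (auto simp: emeasure_lborel_Icc_eq)

lemma cumulated_increment:
  assumes "s \<le> a" "a \<le> b"
  shows "cumulated s b = cumulated s a + cumulated a b" and "cumulated a b \<le> c * (b - a)"
  using set_integral_Icc_add[OF assms hazard_set_integrable]
    set_integral_Icc_bounds(2)[OF assms(2) hazard_set_integrable hazard_nonneg hazard_le] by auto

text \<open>
  Between \<open>a\<close> and \<open>b\<close> the survival factor stays between its values at the two ends, so the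
  mass gained differs from the loss of survival probability by a second-order term only.
\<close>

lemma mass_balance_increment:
  assumes "s \<le> a" "a \<le> b"
  shows "\<bar>(exp (- cumulated s b) + (LINT t:{s..b}|lborel. waiting_density s t))
          - (exp (- cumulated s a) + (LINT t:{s..a}|lborel. waiting_density s t))\<bar> \<le> c\<^sup>2 * (b - a)\<^sup>2"
proof -
  let ?d = "cumulated a b"
  have split: "(LINT t:{s..b}|lborel. waiting_density s t)
      = (LINT t:{s..a}|lborel. waiting_density s t) + (LINT t:{a..b}|lborel. waiting_density s t)"
    by (rule set_integral_Icc_add[OF assms waiting_density_set_integrable])
  have mono: "exp (- cumulated s b) \<le> exp (- cumulated s t)" "exp (- cumulated s t) \<le> exp (- cumulated s a)"
    if "t \<in> {a..b}" for t
    using that assms cumulated_increment(1)[of s a t] cumulated_increment(1)[of s t b]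
      cumulated_nonneg[of a t] cumulated_nonneg[of t b] by auto
  have const: "set_integrable lborel {a..b} (\<lambda>t. h t * k)"
      "(LINT t:{a..b}|lborel. h t * k) = ?d * k" for k
    using hazard_set_integrable[of a b] by auto
  have up: "(LINT t:{a..b}|lborel. waiting_density s t) \<le> ?d * exp (- cumulated s a)"
    unfolding const(2)[symmetric]
    by (rule set_integral_mono)
      (use const waiting_density_set_integrable mono hazard_nonneg in \<open>auto intro!: mult_left_mono\<close>)
  have lo: "?d * exp (- cumulated s b) \<le> (LINT t:{a..b}|lborel. waiting_density s t)"
    unfolding const(2)[symmetric]
    by (rule set_integral_mono)
      (use const waiting_density_set_integrable mono hazard_nonneg in \<open>auto intro!: mult_left_mono\<close>)
  define e where "e = exp (- cumulated s a)"
  have e: "0 \<le> e" "e \<le> 1" using cumulated_nonneg by (auto simp: e_def)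
  have eb: "exp (- cumulated s b) = e * exp (- ?d)"
    by (simp add: cumulated_increment(1)[OF assms] e_def exp_add[symmetric])
  have d0: "0 \<le> ?d" by (rule cumulated_nonneg)
  let ?I = "LINT t:{a..b}|lborel. waiting_density s t"
  have "e * exp (- ?d) + ?I - e \<le> e * (exp (- ?d) - 1 + ?d)"
    using up by (simp add: e_def algebra_simps)
  also have "\<dots> \<le> e * ?d\<^sup>2" using exp_first_order_error(1)[OF d0] e by (intro mult_left_mono) auto
  also have "\<dots> \<le> 1 * ?d\<^sup>2" using e by (intro mult_right_mono) auto
  finally have 1: "e * exp (- ?d) + ?I - e \<le> ?d\<^sup>2" by simp
  have "e - (e * exp (- ?d) + ?I) \<le> e * (1 - exp (- ?d) - ?d * exp (- ?d))"
    using lo unfolding eb by (simp add: algebra_simps)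
  also have "\<dots> \<le> e * ?d\<^sup>2" using exp_first_order_error(2)[OF d0] e by (intro mult_left_mono) auto
  also have "\<dots> \<le> 1 * ?d\<^sup>2" using e by (intro mult_right_mono) auto
  finally have 2: "e - (e * exp (- ?d) + ?I) \<le> ?d\<^sup>2" by simp
  have "?d\<^sup>2 \<le> (c * (b - a))\<^sup>2"
    using cumulated_increment(2)[OF assms] d0 by (intro power_mono)
  with 1 2 show ?thesis
    unfolding split eb e_def[symmetric] by (simp add: power_mult_distrib abs_le_iff)
qed

text \<open>
  Surviving and having jumped are complementary: their total mass has quadratically small
  increments, hence is constant, and it equals \<open>1\<close> at time \<open>s\<close>.
\<close>

lemma waiting_mass_finite_horizon:
  assumes "s \<le> t"
  shows "(LINT u:{s..t}|lborel. waiting_density s u) = 1 - exp (- cumulated s t)"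
proof -
  have null: "(LINT u:{s..s}|lborel. g u) = 0" for g :: "real \<Rightarrow> real"
    unfolding set_lebesgue_integral_def atLeastAtMost_singleton
    by (rule integral_eq_zero_AE) (use AE_lborel_singleton[of s] in \<open>eventually_elim, auto\<close>)
  have "exp (- cumulated s t) + (LINT u:{s..t}|lborel. waiting_density s u)
      = exp (- cumulated s s) + (LINT u:{s..s}|lborel. waiting_density s u)"
    by (rule constant_if_quadratic_increments[OF assms, where k="c\<^sup>2"]) (rule mass_balance_increment)
  then show ?thesis unfolding null by simp
qed

lemma waiting_mass_SUP:
  "(\<integral>\<^sup>+ t. indicator {s<..} t * ennreal (waiting_density s t) \<partial>lborel)
   = (SUP n::nat. ennreal (1 - exp (- cumulated s (s + n))))"
proof -
  have "(\<integral>\<^sup>+ t. indicator {s<..} t * ennreal (waiting_density s t) \<partial>lborel)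
      = (\<integral>\<^sup>+ t. (SUP n::nat. indicator {s..s+n} t * ennreal (waiting_density s t)) \<partial>lborel)"
  proof (rule nn_integral_cong_AE)
    have "AE x in lborel. x \<noteq> s" by (rule AE_lborel_singleton)
    then show "AE t in lborel. indicator {s<..} t * ennreal (waiting_density s t)
        = (SUP n::nat. indicator {s..s+n} t * ennreal (waiting_density s t))"
    proof eventually_elim
      case (elim t)
      show ?case
      proof (cases "s < t")
        case True
        obtain n :: nat where n: "t - s < n" using reals_Archimedean2 by blast
        show ?thesis using True n
          by (intro antisym SUP_upper2[of n] SUP_least) (auto simp: indicator_def)
      next
        case False
        with elim show ?thesis by (auto simp: indicator_def)
      qed
    qed
  qed
  also have "\<dots> = (SUP n::nat. \<integral>\<^sup>+ t. indicator {s..s+n} t * ennreal (waiting_density s t) \<partial>lborel)"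
    by (rule nn_integral_monotone_convergence_SUP)
       (auto simp: incseq_def le_fun_def indicator_def)
  also have "\<dots> = (SUP n::nat. ennreal (1 - exp (- cumulated s (s + n))))"
  proof (intro SUP_cong refl)
    fix n :: nat
    have "(\<integral>\<^sup>+ t. indicator {s..s+n} t * ennreal (waiting_density s t) \<partial>lborel)
        = (\<integral>\<^sup>+ t. ennreal (indicator {s..s+n} t *\<^sub>R waiting_density s t) \<partial>lborel)"
      by (intro nn_integral_cong) (auto simp: indicator_def)
    also have "\<dots> = ennreal (LINT t:{s..s+n}|lborel. waiting_density s t)"
      using waiting_density_set_integrable[of s "s + n" s]
      unfolding set_lebesgue_integral_def[of lborel _ "waiting_density s"] set_integrable_def
      by (intro nn_integral_eq_integral AE_I2) (simp_all add: hazard_nonneg)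
    finally show "(\<integral>\<^sup>+ t. indicator {s..s+n} t * ennreal (waiting_density s t) \<partial>lborel)
        = ennreal (1 - exp (- cumulated s (s + n)))"
      by (simp add: waiting_mass_finite_horizon)
  qed
  finally show ?thesis .
qed

lemma waiting_mass_le_1:
  "(\<integral>\<^sup>+ t. indicator {s<..} t * ennreal (waiting_density s t) \<partial>lborel) \<le> 1"
  unfolding waiting_mass_SUP by (intro SUP_least) (simp add: ennreal_leI flip: ennreal_1)

lemma waiting_mass_eq_1:
  assumes "0 < e" and e: "\<And>t. s \<le> t \<Longrightarrow> e \<le> h t"
  shows "(\<integral>\<^sup>+ t. indicator {s<..} t * ennreal (waiting_density s t) \<partial>lborel) = 1"
proof (rule antisym[OF waiting_mass_le_1])
  have "(\<lambda>n. 1 - exp (- (e * real n))) \<longlonglongrightarrow> 1"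
  proof -
    have "filterlim (\<lambda>n. e * real n) at_top sequentially"
      using \<open>0 < e\<close> by (intro filterlim_tendsto_pos_mult_at_top filterlim_real_sequentially) auto
    then have "(\<lambda>n. exp (- (e * real n))) \<longlonglongrightarrow> 0"
      by (intro filterlim_compose[OF exp_at_bot]) (simp add: filterlim_uminus_at_top)
    then show ?thesis using tendsto_diff[OF tendsto_const[of "1::real"]] by force
  qed
  then have "(\<lambda>n. ennreal (1 - exp (- (e * real n)))) \<longlonglongrightarrow> ennreal 1"
    by (rule tendsto_ennrealI)
  moreover have "ennreal (1 - exp (- (e * real n)))
      \<le> (\<integral>\<^sup>+ t. indicator {s<..} t * ennreal (waiting_density s t) \<partial>lborel)" for n
    unfolding waiting_mass_SUP
  proof (intro SUP_upper2[of n] ennreal_leI)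
    have "e * n \<le> cumulated s (s + n)"
      using set_integral_Icc_bounds(1)[OF _ hazard_set_integrable _ hazard_le, of s "s + n" e] e by simp
    then show "1 - exp (- (e * real n)) \<le> 1 - exp (- cumulated s (s + n))" by simp
  qed simp
  ultimately show "1 \<le> (\<integral>\<^sup>+ t. indicator {s<..} t * ennreal (waiting_density s t) \<partial>lborel)"
    by (intro LIMSEQ_le_const2) auto
qed

end

section \<open>The jump kernel\<close>

text \<open>
  The kernel \<open>jump_kernel\<close> is concentrated on these steps. The second alternative is the encoding
  of a path without a further jump, which repeats the last state.
\<close>

definition regular_step :: "ennreal \<times> 's \<Rightarrow> ennreal \<times> 's \<Rightarrow> bool" where
  "regular_step x y \<longleftrightarrow> fst x < fst y \<and> fst y < \<infinity> \<or> y = (\<infinity>, snd x)"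

lemma regular_step_measurable[measurable]:
  fixes f g :: "'b \<Rightarrow> ennreal \<times> 's::countable"
  assumes [measurable]: "f \<in> M \<rightarrow>\<^sub>M jump_space" "g \<in> M \<rightarrow>\<^sub>M jump_space"
  shows "Measurable.pred M (\<lambda>\<omega>. regular_step (f \<omega>) (g \<omega>))"
proof -
  have "Measurable.pred M (\<lambda>\<omega>. snd (g \<omega>) = snd (f \<omega>))" by measurable
  then show ?thesis unfolding regular_step_def prod_eq_iff fst_conv snd_conv by measurable
qed

text \<open>
  Rates are required to be Borel measurable on the whole real line. Rates of policies, which are
  measurable on \<open>[0, \<infinity>)\<close>, fit after extension by \<open>0\<close> to negative times, which does not change
  the jump law. Conservativity is stated in extended nonnegative reals, the form in which it enters
  the integrals.
\<close>

locale jump_rates =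
  fixes r :: "'s::countable \<Rightarrow> 's \<Rightarrow> real \<Rightarrow> real" and c :: "'s \<Rightarrow> real"
  assumes rate_measurable[measurable]: "r j i \<in> borel_measurable borel"
    and rate_nonneg: "j \<noteq> i \<Longrightarrow> 0 \<le> r j i t"
    and exit_rate_nonneg: "0 \<le> - r i i t"
    and exit_rate_le: "- r i i t \<le> c i"
    and rate_sum: "(\<integral>\<^sup>+ j. (if j = i then 0 else ennreal (r j i t)) \<partial>count_space UNIV) = ennreal (- r i i t)"
begin

lemma hazard_exit_rate: "hazard (\<lambda>t. - r i i t) (c i)"
  by unfold_locales (auto simp: exit_rate_le exit_rate_nonneg simp del: neg_0_le_iff_le)

abbreviation survival :: "'s \<Rightarrow> real \<Rightarrow> real \<Rightarrow> real" where
  "survival i s t \<equiv> exp (- (LINT u:{s..t}|lborel. - r i i u))"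

lemma jump_density_measurable[measurable]:
  "(\<lambda>(x, z). jump_density r x z)
     \<in> borel_measurable (jump_space \<Otimes>\<^sub>M (lborel \<Otimes>\<^sub>M count_space UNIV))"
proof -
  let ?M = "(jump_space :: (ennreal \<times> 's) measure) \<Otimes>\<^sub>M (lborel \<Otimes>\<^sub>M (count_space UNIV :: 's measure))"
  define F :: "'s \<Rightarrow> 's \<Rightarrow> (ennreal \<times> 's) \<times> real \<times> 's \<Rightarrow> ennreal" where
    "F i j x = (if fst (fst x) < ennreal (fst (snd x)) \<and> j \<noteq> i
      then ennreal (r j i (fst (snd x)) * survival i (enn2real (fst (fst x))) (fst (snd x))) else 0)" for i j x
  have F[measurable]: "F i j \<in> borel_measurable ?M" for i j
    unfolding F_def by measurable
  \<comment> \<open>The rates carry no structure in the two states; joint measurability holds because there are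
    only countably many pairs of states.\<close>
  have "(\<lambda>x. F (snd (fst x)) (snd (snd x)) x) \<in> borel_measurable ?M"
    by (rule measurable_compose_countable[where f = "\<lambda>i x. F i (snd (snd x)) x"],
        rule measurable_compose_countable[where f = "\<lambda>j x. F _ j x"]) measurable
  also have "(\<lambda>x. F (snd (fst x)) (snd (snd x)) x) = (\<lambda>(x, z). jump_density r x z)"
    by (auto simp: F_def jump_density_def fun_eq_iff)
  finally show ?thesis .
qed

lemma jump_density_measurable'[measurable]:
  "jump_density r x \<in> borel_measurable (lborel \<Otimes>\<^sub>M count_space UNIV)"
  using measurable_compose[OF measurable_Pair1'[of x jump_space] jump_density_measurable]
  by (simp add: space_pair_measure)

lemma finite_jump_law_map_measurable[measurable]:
  "(\<lambda>(t, j). (ennreal t, j)) \<in> (lborel \<Otimes>\<^sub>M count_space UNIV) \<rightarrow>\<^sub>M (jump_space :: (ennreal \<times> 's) measure)"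
  by measurable

lemma sets_finite_jump_law[simp, measurable_cong]: "sets (finite_jump_law r x) = sets jump_space"
  by (simp add: finite_jump_law_def)

lemma space_finite_jump_law[simp]: "space (finite_jump_law r x) = UNIV"
  by (simp add: finite_jump_law_def space_pair_measure)

lemma nn_integral_finite_jump_law:
  assumes [measurable]: "f \<in> borel_measurable jump_space"
  shows "(\<integral>\<^sup>+ y. f y \<partial>finite_jump_law r x)
    = (\<integral>\<^sup>+ z. jump_density r x z * f (case z of (t, j) \<Rightarrow> (ennreal t, j)) \<partial>(lborel \<Otimes>\<^sub>M count_space UNIV))"
  unfolding finite_jump_law_def
  by (simp add: nn_integral_distr nn_integral_density)

lemma emeasure_finite_jump_law:
  assumes [measurable]: "E \<in> sets jump_space"
  shows "emeasure (finite_jump_law r x) E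
    = (\<integral>\<^sup>+ z. jump_density r x z * indicator E (case z of (t, j) \<Rightarrow> (ennreal t, j))
        \<partial>(lborel \<Otimes>\<^sub>M count_space UNIV))"
  using nn_integral_finite_jump_law[of "indicator E" x] by simp

text \<open>
  Wait until time \<open>t\<close>, then choose the new state: the survival factor does not depend on the
  state entered and leaves the inner integral.
\<close>

lemma finite_jump_law_iterated:
  assumes "0 \<le> a" and [measurable]: "f \<in> borel_measurable jump_space"
  shows "(\<integral>\<^sup>+ y. f y \<partial>finite_jump_law r (ennreal a, i))
    = (\<integral>\<^sup>+ t. indicator {a<..} t * ennreal (survival i a t) *
        (\<integral>\<^sup>+ j. (if j = i then 0 else ennreal (r j i t)) * f (ennreal t, j) \<partial>count_space UNIV) \<partial>lborel)"
proof -
  interpret C: sigma_finite_measure "count_space (UNIV :: 's set)"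
    by (rule sigma_finite_measure_count_space)
  have "(\<integral>\<^sup>+ y. f y \<partial>finite_jump_law r (ennreal a, i))
    = (\<integral>\<^sup>+ t. \<integral>\<^sup>+ j. jump_density r (ennreal a, i) (t, j) * f (ennreal t, j) \<partial>count_space UNIV \<partial>lborel)"
    unfolding nn_integral_finite_jump_law[OF assms(2)]
    by (subst C.nn_integral_fst[symmetric]) auto
  also have "\<dots> = (\<integral>\<^sup>+ t. \<integral>\<^sup>+ j. indicator {a<..} t * ennreal (survival i a t) *
        ((if j = i then 0 else ennreal (r j i t)) * f (ennreal t, j)) \<partial>count_space UNIV \<partial>lborel)"
    using \<open>0 \<le> a\<close>
    by (intro nn_integral_cong)
       (auto simp: jump_density_def ennreal_less_iff rate_nonneg ennreal_mult indicator_def ac_simps)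
  finally show ?thesis by (simp add: nn_integral_cmult)
qed

lemma finite_jump_law_infinity: "emeasure (finite_jump_law r (\<infinity>, i)) E = 0"
proof (cases "E \<in> sets jump_space")
  case True
  have "jump_density r (\<infinity>, i) z = 0" for z by (auto simp: jump_density_def split: prod.split)
  with True show ?thesis by (simp add: emeasure_finite_jump_law)
qed (simp add: emeasure_notin_sets)

lemma finite_jump_law_mass:
  assumes "0 \<le> a"
  shows "emeasure (finite_jump_law r (ennreal a, i)) UNIV
    = (\<integral>\<^sup>+ t. indicator {a<..} t * ennreal (- r i i t * survival i a t) \<partial>lborel)"
proof -
  have "emeasure (finite_jump_law r (ennreal a, i)) UNIV = (\<integral>\<^sup>+ y. 1 \<partial>finite_jump_law r (ennreal a, i))"
    by simp
  also have "\<dots> = (\<integral>\<^sup>+ t. indicator {a<..} t * ennreal (survival i a t) * ennreal (- r i i t) \<partial>lborel)"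
    by (subst finite_jump_law_iterated[OF assms]) (simp_all add: rate_sum del: space_finite_jump_law)
  also have "\<dots> = (\<integral>\<^sup>+ t. indicator {a<..} t * ennreal (- r i i t * survival i a t) \<partial>lborel)"
    using exit_rate_nonneg
    by (intro nn_integral_cong) (subst ennreal_mult, auto simp: ac_simps simp del: neg_0_le_iff_le)
  finally show ?thesis .
qed

lemma finite_jump_law_mass_le_1: "emeasure (finite_jump_law r x) UNIV \<le> 1"
proof (cases x)
  case (Pair s i)
  interpret hazard "\<lambda>t. - r i i t" "c i" by (rule hazard_exit_rate)
  show ?thesis
    by (cases s) (use waiting_mass_le_1 finite_jump_law_infinity in \<open>auto simp: Pair finite_jump_law_mass\<close>)
qed

lemma finite_jump_law_mass_eq_1:
  assumes "0 \<le> a" "0 < e" "\<And>t. 0 \<le> t \<Longrightarrow> e \<le> - r i i t"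
  shows "emeasure (finite_jump_law r (ennreal a, i)) UNIV = 1"
proof -
  interpret hazard "\<lambda>t. - r i i t" "c i" by (rule hazard_exit_rate)
  show ?thesis
    using waiting_mass_eq_1[OF assms(2), of a] assms by (auto simp: finite_jump_law_mass)
qed

lemma sets_jump_kernel[simp, measurable_cong]: "sets (jump_kernel r x) = sets jump_space"
  using sets.sigma_sets_eq[of "jump_space :: (ennreal \<times> 's) measure"]
  by (simp add: jump_kernel_def space_pair_measure)

lemma space_jump_kernel[simp]: "space (jump_kernel r x) = UNIV"
  by (simp add: jump_kernel_def)

lemma emeasure_jump_kernel:
  assumes "E \<in> sets jump_space"
  shows "emeasure (jump_kernel r x) E = emeasure (finite_jump_law r x) E +
          (1 - emeasure (finite_jump_law r x) UNIV) * indicator E (\<infinity>, snd x)"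
proof (rule emeasure_measure_of[OF jump_kernel_def])
  let ?c = "1 - emeasure (finite_jump_law r x) UNIV"
  let ?D = "return jump_space (\<infinity>, snd x) :: (ennreal \<times> 's) measure"
  show "countably_additive (sets (jump_kernel r x)) (\<lambda>E. emeasure (finite_jump_law r x) E +
          ?c * indicator E (\<infinity>, snd x))"
  proof (rule countably_additiveI)
    fix X :: "nat \<Rightarrow> (ennreal \<times> 's) set"
    assume X: "range X \<subseteq> sets (jump_kernel r x)" "disjoint_family X"
      "\<Union> (range X) \<in> sets (jump_kernel r x)"
    then have [measurable]: "X n \<in> sets jump_space" for n by auto
    have "(\<Sum>n. emeasure (finite_jump_law r x) (X n) + ?c * emeasure ?D (X n))
        = (\<Sum>n. emeasure (finite_jump_law r x) (X n)) + ?c * (\<Sum>n. emeasure ?D (X n))"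
      by (subst suminf_add[symmetric]) auto
    also have "\<dots> = emeasure (finite_jump_law r x) (\<Union>n. X n) + ?c * emeasure ?D (\<Union>n. X n)"
      using X by (subst (1 2) suminf_emeasure) auto
    finally show "(\<Sum>n. emeasure (finite_jump_law r x) (X n) + ?c * indicator (X n) (\<infinity>, snd x))
        = emeasure (finite_jump_law r x) (\<Union>n. X n) + ?c * indicator (\<Union>n. X n) (\<infinity>, snd x)"
      by (simp add: emeasure_return[of _ jump_space])
  qed
qed (use assms in \<open>auto simp: positive_def\<close>)

lemma prob_space_jump_kernel: "prob_space (jump_kernel r x)"
proof (rule prob_spaceI)
  have "UNIV \<in> sets (jump_space :: (ennreal \<times> 's) measure)"
    using sets.top[of "jump_space :: (ennreal \<times> 's) measure"] by (simp add: space_pair_measure)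
  then show "emeasure (jump_kernel r x) (space (jump_kernel r x)) = 1"
    using finite_jump_law_mass_le_1[of x]
    by (simp add: emeasure_jump_kernel diff_add_self_ennreal add.commute)
qed

lemma emeasure_finite_jump_law_measurable[measurable]:
  assumes [measurable]: "E \<in> sets jump_space"
  shows "(\<lambda>x. emeasure (finite_jump_law r x) E) \<in> borel_measurable jump_space"
proof -
  interpret pair_sigma_finite lborel "count_space (UNIV :: 's set)"
    by (intro pair_sigma_finite.intro lborel.sigma_finite_measure_axioms sigma_finite_measure_count_space)
  show ?thesis unfolding emeasure_finite_jump_law[OF assms]
    by (rule borel_measurable_nn_integral) measurable
qed

lemma jump_kernel_measurable[measurable]:
  "jump_kernel r \<in> jump_space \<rightarrow>\<^sub>M subprob_algebra jump_space"
proof (rule measurable_subprob_algebra)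
  fix E :: "(ennreal \<times> 's) set" assume [measurable]: "E \<in> sets jump_space"
  have [measurable]: "UNIV \<in> sets (jump_space :: (ennreal \<times> 's) measure)"
    using sets.top[of "jump_space :: (ennreal \<times> 's) measure"] by (simp add: space_pair_measure)
  show "(\<lambda>x. emeasure (jump_kernel r x) E) \<in> borel_measurable jump_space"
    by (simp add: emeasure_jump_kernel)
qed (auto intro: prob_space_imp_subprob_space prob_space_jump_kernel)

lemma jump_kernel_eq_finite_jump_law:
  "emeasure (finite_jump_law r x) UNIV = 1 \<Longrightarrow> jump_kernel r x = finite_jump_law r x"
  by (intro measure_eqI) (auto simp: emeasure_jump_kernel)

lemma AE_jump_kernel_regular: "AE y in jump_kernel r x. regular_step x y"
proof -
  have measurable[measurable]: "{y. \<not> regular_step x y} \<in> sets jump_space"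
  proof -
    have [measurable]: "Measurable.pred jump_space (regular_step x)"
      by (rule regular_step_measurable) (auto simp: space_pair_measure)
    have "{y \<in> space jump_space. \<not> regular_step x y} \<in> sets jump_space" by measurable
    then show ?thesis by (simp add: space_pair_measure)
  qed
  have null: "jump_density r x z * indicator {y. \<not> regular_step x y} (case z of (t, j) \<Rightarrow> (ennreal t, j)) = 0" for z
    by (auto simp: jump_density_def regular_step_def indicator_def split: prod.splits)
  have "emeasure (finite_jump_law r x) {y. \<not> regular_step x y} = 0"
    by (simp only: emeasure_finite_jump_law[OF measurable] null nn_integral_0_iff_AE) simp
  moreover have "indicator {y. \<not> regular_step x y} (\<infinity>, snd x) = (0 :: ennreal)"
    by (simp add: regular_step_def indicator_def)
  ultimately have "emeasure (jump_kernel r x) {y. \<not> regular_step x y} = 0"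
    by (simp only: emeasure_jump_kernel[OF measurable] mult_zero_right add_0)
  then show ?thesis by (auto simp: AE_iff_measurable[OF _ refl])
qed

end

section \<open>Hitting times of paths\<close>

lemma space_jump_space[simp]: "space jump_space = UNIV"
  by (simp add: space_pair_measure)

lemma hitting_time_finite_iff:
  "hitting_time B \<omega> < \<infinity> \<longleftrightarrow> (\<exists>t\<ge>0. state_at \<omega> t \<in> Some ` B)"
  unfolding hitting_time_def Inf_less_iff using ennreal_less_top by fastforce

text \<open>
  The index found by \<open>state_at\<close>. On an arbitrary sequence, without monotone jump times, several
  indices may qualify at time \<open>t\<close>, and the least one counts.
\<close>

definition current_index :: "(nat \<Rightarrow> ennreal \<times> 's) \<Rightarrow> real \<Rightarrow> nat \<Rightarrow> bool" where
  "current_index \<omega> t n \<longleftrightarrow> fst (\<omega> n) \<le> ennreal t \<and> ennreal t < fst (\<omega> (Suc n)) \<and>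
     (\<forall>m<n. \<not> (fst (\<omega> m) \<le> ennreal t \<and> ennreal t < fst (\<omega> (Suc m))))"

lemma state_at_in_iff:
  "state_at \<omega> t \<in> Some ` B \<longleftrightarrow> (\<exists>n. current_index \<omega> t n \<and> snd (\<omega> n) \<in> B)"
proof -
  let ?cur = "\<lambda>n. fst (\<omega> n) \<le> ennreal t \<and> ennreal t < fst (\<omega> (Suc n))"
  have "(P n \<and> (\<forall>m<n. \<not> P m)) \<longleftrightarrow> (\<exists>n. P n) \<and> n = (LEAST n. P n)" for P :: "nat \<Rightarrow> bool" and n
  proof
    assume "P n \<and> (\<forall>m<n. \<not> P m)"
    then have "(LEAST n. P n) = n" by (intro Least_equality) (auto simp: not_less[symmetric])
    with \<open>P n \<and> _\<close> show "(\<exists>n. P n) \<and> n = (LEAST n. P n)" by auto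
  qed (auto intro: LeastI dest: not_less_Least)
  from this[of ?cur] have least: "current_index \<omega> t n \<longleftrightarrow> (\<exists>n. ?cur n) \<and> n = (LEAST n. ?cur n)" for n
    unfolding current_index_def conj_assoc .
  show ?thesis
  proof (cases "\<exists>n. ?cur n")
    case True
    then show ?thesis unfolding least state_at_def Let_def by (simp add: image_iff)
  next
    case False
    then show ?thesis unfolding least state_at_def Let_def by (simp add: image_iff)
  qed
qed

text \<open>
  Membership of \<open>t\<close> in the intervals \<open>[fst (\<omega> m), fst (\<omega> (Suc m)))\<close> with \<open>m \<le> n\<close> is locally
  constant to the right, so a rational time slightly after \<open>t\<close> has the same current index. This reduces the
  uncountable union over \<open>t\<close> in the hitting event to a countable one.
\<close>

lemma current_index_rational:
  assumes "0 \<le> t" "current_index \<omega> t n"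
  shows "\<exists>q::rat. 0 \<le> q \<and> current_index \<omega> (of_rat q) n"
proof -
  have "\<forall>\<^sub>F u in at_right t. (fst (\<omega> m) \<le> ennreal u) = (fst (\<omega> m) \<le> ennreal t)" for m
  proof (cases "fst (\<omega> m) \<le> ennreal t")
    case True
    have "\<forall>\<^sub>F u in at_right t. t < u" by (simp add: eventually_at_filter)
    then show ?thesis
    proof eventually_elim
      case (elim u)
      then have "ennreal t \<le> ennreal u" by (simp add: ennreal_leI)
      with True show ?case by auto
    qed
  next
    case False
    have "((\<lambda>u. ennreal u) \<longlongrightarrow> ennreal t) (at_right t)"
      by (intro tendsto_ennrealI tendsto_ident_at)
    then have "\<forall>\<^sub>F u in at_right t. ennreal u < fst (\<omega> m)"
      by (rule order_tendstoD) (use False in auto)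
    then show ?thesis by eventually_elim (use False in auto)
  qed
  then have "\<forall>\<^sub>F u in at_right t. \<forall>m\<in>{..Suc n}. (fst (\<omega> m) \<le> ennreal u) = (fst (\<omega> m) \<le> ennreal t)"
    by (intro eventually_ball_finite) auto
  then obtain b where b: "t < b"
      "\<And>u m. t < u \<Longrightarrow> u < b \<Longrightarrow> m \<le> Suc n \<Longrightarrow> (fst (\<omega> m) \<le> ennreal u) = (fst (\<omega> m) \<le> ennreal t)"
    unfolding eventually_at_right_field by (metis atMost_iff)
  obtain q where q: "t < of_rat q" "of_rat q < b"
    using of_rat_dense[OF b(1)] by blast
  have eq: "(fst (\<omega> m) \<le> ennreal (of_rat q)) = (fst (\<omega> m) \<le> ennreal t)" if "m \<le> Suc n" for m
    using b(2)[OF q that] .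
  have "current_index \<omega> (of_rat q) n"
    using assms(2) unfolding current_index_def not_le[symmetric] by (auto simp: eq)
  moreover have "0 \<le> q" using less_imp_le[OF le_less_trans[OF assms(1) q(1)]] by simp
  ultimately show ?thesis by blast
qed

lemma hitting_time_measurable:
  fixes B :: "'s::countable set"
  assumes M: "sets M = sets (PiM UNIV (\<lambda>_::nat. jump_space :: (ennreal \<times> 's) measure))"
  shows "{\<omega> \<in> space M. hitting_time B \<omega> < \<infinity>} \<in> sets M"
proof -
  note [measurable_cong] = M
  have "hitting_time B \<omega> < \<infinity> \<longleftrightarrow>
      (\<exists>q::rat. 0 \<le> q \<and> (\<exists>n. current_index \<omega> (of_rat q) n \<and> snd (\<omega> n) \<in> B))" for \<omega>
  proof
    assume "hitting_time B \<omega> < \<infinity>"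
    then obtain t n where t: "0 \<le> t" "current_index \<omega> t n" "snd (\<omega> n) \<in> B"
      unfolding hitting_time_finite_iff state_at_in_iff by blast
    then show "\<exists>q::rat. 0 \<le> q \<and> (\<exists>n. current_index \<omega> (of_rat q) n \<and> snd (\<omega> n) \<in> B)"
      using current_index_rational[OF t(1,2)] by blast
  next
    assume "\<exists>q::rat. 0 \<le> q \<and> (\<exists>n. current_index \<omega> (of_rat q) n \<and> snd (\<omega> n) \<in> B)"
    then obtain q :: rat and n where "0 \<le> q" "current_index \<omega> (of_rat q) n" "snd (\<omega> n) \<in> B"
      by blast
    then show "hitting_time B \<omega> < \<infinity>"
      unfolding hitting_time_finite_iff state_at_in_iff
      by (intro exI[of _ "of_rat q"]) auto
  qed
  moreover have "Measurable.pred M (\<lambda>\<omega>. \<exists>q::rat. 0 \<le> q \<and> (\<exists>n. current_index \<omega> (of_rat q) n \<and> snd (\<omega> n) \<in> B))"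
  proof -
    have [measurable]: "Measurable.pred M (\<lambda>\<omega>. fst (\<omega> n) \<le> ennreal t \<and> ennreal t < fst (\<omega> (Suc n)))" for n t
      by measurable
    have [measurable]: "Measurable.pred M (\<lambda>\<omega>. current_index \<omega> t n)" for n t
      unfolding current_index_def conj_assoc[symmetric] by measurable
    show ?thesis by measurable
  qed
  ultimately show ?thesis by (simp only: pred_def)
qed

context jump_rates
begin

text \<open>
  Take the first entry in \<open>B\<close>. It is the initial one or differs from its predecessor, so it was
  entered at a finite time, and since the jump times increase, it is the state at that time.
\<close>

lemma regular_path_hits_iff:
  assumes start: "\<omega> 0 = (0, i)" and regular: "\<And>n. regular_step (\<omega> n) (\<omega> (Suc n))"
  shows "hitting_time B \<omega> < \<infinity> \<longleftrightarrow> (\<exists>n. snd (\<omega> n) \<in> B)"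
proof
  assume "hitting_time B \<omega> < \<infinity>"
  then show "\<exists>n. snd (\<omega> n) \<in> B"
    unfolding hitting_time_finite_iff state_at_in_iff by blast
next
  assume ex: "\<exists>n. snd (\<omega> n) \<in> B"
  define n where "n = (LEAST n. snd (\<omega> n) \<in> B)"
  have n: "snd (\<omega> n) \<in> B" and before: "\<And>m. m < n \<Longrightarrow> snd (\<omega> m) \<notin> B"
    using LeastI_ex[OF ex] not_less_Least by (auto simp: n_def)
  have finite: "fst (\<omega> n) < \<infinity>"
  proof (cases n)
    case (Suc m)
    then show ?thesis using regular[of m] n before[of m] by (auto simp: regular_step_def)
  qed (simp add: start)
  have "fst (\<omega> n) \<le> fst (\<omega> (Suc n))" for n
    using regular[of n] by (auto simp: regular_step_def)
  then have mono: "mono (\<lambda>n. fst (\<omega> n))"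
    unfolding mono_iff_le_Suc by blast
  obtain t where t: "0 \<le> t" "fst (\<omega> n) = ennreal t"
    using finite by (cases "fst (\<omega> n)") auto
  have "ennreal t < fst (\<omega> (Suc n))"
    using regular[of n] finite t by (auto simp: regular_step_def)
  moreover have "fst (\<omega> (Suc m)) \<le> ennreal t" if "m < n" for m
    using monoD[OF mono, of "Suc m" n] that t by simp
  ultimately have "current_index \<omega> t n"
    using t by (auto simp: current_index_def not_less)
  with n t show "hitting_time B \<omega> < \<infinity>"
    unfolding hitting_time_finite_iff state_at_in_iff by blast
qed

section \<open>Hitting probabilities as limits over the number of jumps\<close>

lemma jump_step_Ionescu_Tulcea: "Ionescu_Tulcea (jump_step r i) (\<lambda>_. jump_space)"
proof (rule Ionescu_Tulcea.intro)
  show "jump_step r i n \<in> PiM {0..<n} (\<lambda>_. jump_space) \<rightarrow>\<^sub>M subprob_algebra jump_space" for n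
  proof (cases n)
    case 0
    then show ?thesis
      by (auto intro!: measurable_const simp: space_subprob_algebra subprob_space_return)
  next
    case (Suc m)
    then show ?thesis by simp
  qed
  show "prob_space (jump_step r i n \<omega>)" for n \<omega>
    by (cases n) (auto intro: prob_space_return prob_space_jump_kernel)
qed

text \<open>
  The joint law of the first \<open>n\<close> entries, on which the recursion over jumps is carried out before
  passing to the projective limit.
\<close>

abbreviation prefix_law :: "'s \<Rightarrow> nat \<Rightarrow> (nat \<Rightarrow> ennreal \<times> 's) measure" where
  "prefix_law i n \<equiv> Ionescu_Tulcea.C (jump_step r i) (\<lambda>_. jump_space) 0 n (\<lambda>_. undefined)"

lemma sets_prefix_law[measurable_cong]: "sets (prefix_law i n) = sets (PiM {0..<n} (\<lambda>_. jump_space))"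
proof -
  interpret Ionescu_Tulcea "jump_step r i" "\<lambda>_. jump_space" by (rule jump_step_Ionescu_Tulcea)
  show ?thesis by (simp add: sets_C)
qed

lemma sets_jump_law[simp, measurable_cong]: "sets (jump_law r i) = sets (PiM UNIV (\<lambda>_. jump_space))"
proof -
  interpret Ionescu_Tulcea "jump_step r i" "\<lambda>_. jump_space" by (rule jump_step_Ionescu_Tulcea)
  show ?thesis by (simp add: jump_law_def)
qed

lemma distr_jump_law_prefix:
  "distr (jump_law r i) (PiM {0..<n} (\<lambda>_. jump_space)) (\<lambda>\<omega>. restrict \<omega> {0..<n}) = prefix_law i n"
proof -
  interpret Ionescu_Tulcea "jump_step r i" "\<lambda>_. jump_space" by (rule jump_step_Ionescu_Tulcea)
  have "distr (jump_law r i) (PiM {0..<n} (\<lambda>_. jump_space)) (\<lambda>\<omega>. restrict \<omega> {0..<n}) = CI {0..<n}"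
    unfolding jump_law_def by (rule distr_lim) simp
  also have "\<dots> = prefix_law i n"
  proof (rule measure_eqI)
    fix X assume "X \<in> sets (CI {0..<n})"
    then have X: "X \<in> sets (PiM {0..<n} (\<lambda>_. jump_space))" by (simp add: CI_def)
    then show "emeasure (CI {0..<n}) X = emeasure (prefix_law i n) X"
      using prod_emb_id[OF sets.sets_into_space[OF X, unfolded space_PiM]]
      by (subst emeasure_CI[OF subset_refl X]) simp
  qed (simp add: CI_def sets_C)
  finally show ?thesis .
qed

lemma prob_space_jump_law: "prob_space (jump_law r i)"
proof -
  interpret Ionescu_Tulcea "jump_step r i" "\<lambda>_. jump_space" by (rule jump_step_Ionescu_Tulcea)
  have "prob_space (prefix_law i 0)" by (rule prob_space_C) simp
  then show ?thesis
    unfolding distr_jump_law_prefix[symmetric]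
    by (rule prob_space_distrD[rotated]) measurable
qed

lemma nn_integral_prefix_law_first:
  assumes [measurable]: "f \<in> borel_measurable (PiM {0..<Suc 0} (\<lambda>_. jump_space))"
  shows "(\<integral>\<^sup>+ \<omega>. f \<omega> \<partial>prefix_law i (Suc 0)) = f ((\<lambda>_. undefined)(0 := (0, i)))"
proof -
  interpret Ionescu_Tulcea "jump_step r i" "\<lambda>_. jump_space" by (rule jump_step_Ionescu_Tulcea)
  have u: "(\<lambda>_. undefined) \<in> space (PiM {0..<0::nat} (\<lambda>_. jump_space :: (ennreal \<times> 's) measure))"
    by (simp add: space_PiM)
  have [measurable]: "(\<lambda>x. f ((\<lambda>_. undefined)(0 := x))) \<in> borel_measurable jump_space"
    by (rule measurable_compose[OF _ assms], rule measurable_fun_upd[where J="{}"])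
      (auto simp: space_PiM)
  have "(\<integral>\<^sup>+ \<omega>. f \<omega> \<partial>prefix_law i (Suc 0)) = (\<integral>\<^sup>+ \<omega>. f \<omega> \<partial>eP 0 (\<lambda>_. undefined))"
    using bind_return[OF measurable_eP u] by simp
  also have "\<dots> = (\<integral>\<^sup>+ x. f ((\<lambda>_. undefined)(0 := x)) \<partial>return jump_space (0, i))"
    by (subst nn_integral_eP[OF u assms]) simp
  also have "\<dots> = f ((\<lambda>_. undefined)(0 := (0, i)))"
    by (subst nn_integral_return) auto
  finally show ?thesis .
qed

lemma nn_integral_prefix_law_Suc:
  assumes [measurable]: "f \<in> borel_measurable (PiM {0..<Suc (Suc n)} (\<lambda>_. jump_space))"
  shows "(\<integral>\<^sup>+ \<omega>. f \<omega> \<partial>prefix_law i (Suc (Suc n)))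
    = (\<integral>\<^sup>+ \<omega>. \<integral>\<^sup>+ y. f (fun_upd \<omega> (Suc n) y) \<partial>jump_kernel r (\<omega> n) \<partial>prefix_law i (Suc n))"
proof -
  interpret Ionescu_Tulcea "jump_step r i" "\<lambda>_. jump_space" by (rule jump_step_Ionescu_Tulcea)
  have eP: "eP (Suc n) \<in> prefix_law i (Suc n) \<rightarrow>\<^sub>M subprob_algebra (PiM {0..<Suc (Suc n)} (\<lambda>_. jump_space))"
    using measurable_eP[of "Suc n"] by (simp add: measurable_cong_sets[OF sets_prefix_law refl] del: C.simps)
  have "prefix_law i (Suc (Suc n)) = prefix_law i (Suc n) \<bind> eP (Suc n)"
    by (subst C.simps(2)) simp
  then have "(\<integral>\<^sup>+ \<omega>. f \<omega> \<partial>prefix_law i (Suc (Suc n)))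
      = (\<integral>\<^sup>+ \<omega>. \<integral>\<^sup>+ \<omega>'. f \<omega>' \<partial>eP (Suc n) \<omega> \<partial>prefix_law i (Suc n))"
    by (simp only: nn_integral_bind[OF assms eP])
  also have "\<dots> = (\<integral>\<^sup>+ \<omega>. \<integral>\<^sup>+ y. f (fun_upd \<omega> (Suc n) y) \<partial>jump_kernel r (\<omega> n) \<partial>prefix_law i (Suc n))"
    by (intro nn_integral_cong, subst nn_integral_eP)
      (simp_all add: sets_eq_imp_space_eq[OF sets_prefix_law] del: C.simps)
  finally show ?thesis .
qed

lemma nn_integral_jump_law_prefix:
  assumes "f \<in> borel_measurable (PiM {0..<n} (\<lambda>_. jump_space))"
  shows "(\<integral>\<^sup>+ \<omega>. f (restrict \<omega> {0..<n}) \<partial>jump_law r i) = (\<integral>\<^sup>+ \<omega>. f \<omega> \<partial>prefix_law i n)"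
  unfolding distr_jump_law_prefix[symmetric]
  by (subst nn_integral_distr) (use assms in \<open>auto intro: measurable_restrict_subset\<close>)

lemma AE_jump_law_start: "AE \<omega> in jump_law r i. \<omega> 0 = (0, i)"
proof -
  let ?f = "\<lambda>\<omega> :: nat \<Rightarrow> ennreal \<times> 's. if fst (\<omega> 0) = 0 \<and> snd (\<omega> 0) = i then 0 else 1 :: ennreal"
  have [measurable]: "?f \<in> borel_measurable (PiM {0..<Suc 0} (\<lambda>_. jump_space))"
    by measurable
  have "(\<integral>\<^sup>+ \<omega>. ?f \<omega> \<partial>jump_law r i) = (\<integral>\<^sup>+ \<omega>. ?f \<omega> \<partial>prefix_law i (Suc 0))"
    by (subst nn_integral_jump_law_prefix[symmetric]) simp_all
  also have "\<dots> = 0"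
    by (subst nn_integral_prefix_law_first) auto
  finally have "AE \<omega> in jump_law r i. ?f \<omega> = 0"
    by (subst (asm) nn_integral_0_iff_AE) auto
  then show ?thesis by eventually_elim (auto simp: prod_eq_iff split: if_splits)
qed

lemma AE_jump_law_regular: "AE \<omega> in jump_law r i. regular_step (\<omega> n) (\<omega> (Suc n))"
proof -
  let ?f = "\<lambda>\<omega> :: nat \<Rightarrow> ennreal \<times> 's. if regular_step (\<omega> n) (\<omega> (Suc n)) then 0 else 1 :: ennreal"
  have [measurable]: "?f \<in> borel_measurable (PiM {0..<Suc (Suc n)} (\<lambda>_. jump_space))"
      "?f \<in> borel_measurable (PiM UNIV (\<lambda>_. jump_space))"
    by measurable
  have "(\<integral>\<^sup>+ \<omega>. ?f \<omega> \<partial>jump_law r i) = (\<integral>\<^sup>+ \<omega>. ?f \<omega> \<partial>prefix_law i (Suc (Suc n)))"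
    by (subst nn_integral_jump_law_prefix[symmetric]) simp_all
  also have "\<dots> = (\<integral>\<^sup>+ \<omega>. \<integral>\<^sup>+ y. ?f (fun_upd \<omega> (Suc n) y) \<partial>jump_kernel r (\<omega> n) \<partial>prefix_law i (Suc n))"
    by (rule nn_integral_prefix_law_Suc) measurable
  also have "\<dots> = (\<integral>\<^sup>+ \<omega>. \<integral>\<^sup>+ y. 0 \<partial>jump_kernel r (\<omega> n) \<partial>prefix_law i (Suc n))"
  proof (rule nn_integral_cong, rule nn_integral_cong_AE)
    fix \<omega> :: "nat \<Rightarrow> ennreal \<times> 's"
    show "AE y in jump_kernel r (\<omega> n). ?f (fun_upd \<omega> (Suc n) y) = 0"
      using AE_jump_kernel_regular[of "\<omega> n"] by eventually_elim simp
  qed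
  also have "\<dots> = 0" by simp
  finally have "AE \<omega> in jump_law r i. ?f \<omega> = 0"
    by (subst (asm) nn_integral_0_iff_AE) simp_all
  then show ?thesis by eventually_elim (auto split: if_splits)
qed

text \<open>
  The conditional probability that one of the next \<open>k\<close> entries or the present one lies in \<open>B\<close>,
  given the present entry.
\<close>

primrec hit_within :: "'s set \<Rightarrow> nat \<Rightarrow> ennreal \<times> 's \<Rightarrow> ennreal" where
  "hit_within B 0 = (\<lambda>x. indicator B (snd x))"
| "hit_within B (Suc k) = (\<lambda>x. if snd x \<in> B then 1 else \<integral>\<^sup>+ y. hit_within B k y \<partial>jump_kernel r x)"

lemma hit_within_measurable[measurable]: "hit_within B k \<in> borel_measurable jump_space"
proof (induction k)
  case (Suc k)
  have "Measurable.pred jump_space (\<lambda>x :: ennreal \<times> 's. snd x \<in> B)" by measurable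
  moreover have "(\<lambda>x. \<integral>\<^sup>+ y. hit_within B k y \<partial>jump_kernel r x) \<in> borel_measurable jump_space"
    by (rule measurable_compose[OF jump_kernel_measurable nn_integral_measurable_subprob_algebra, OF Suc.IH])
  ultimately show ?case
    unfolding hit_within.simps by (intro measurable_If) (auto simp: pred_def)
qed simp

lemma hit_within_target: "snd x \<in> B \<Longrightarrow> hit_within B k x = 1"
  by (cases k) auto

text \<open>
  Stated for any index set that contains the first entries, as it is used both for prefixes and for
  whole paths.
\<close>

lemma sets_hit_prefix:
  fixes n :: nat
  assumes "{..n} \<subseteq> I"
  shows "{\<omega> \<in> space (PiM I (\<lambda>_. jump_space)). \<exists>l\<le>n. snd (\<omega> l) \<in> B}
    \<in> sets (PiM I (\<lambda>_. jump_space :: (ennreal \<times> 's) measure))"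
proof -
  have component: "{\<omega> \<in> space (PiM I (\<lambda>_. jump_space)). snd (\<omega> l) \<in> B}
      \<in> sets (PiM I (\<lambda>_. jump_space :: (ennreal \<times> 's) measure))" if "l \<in> {..n}" for l
  proof -
    have [measurable]: "l \<in> I" using that assms by auto
    show ?thesis by measurable
  qed
  have "(\<Union>l\<in>{..n}. {\<omega> \<in> space (PiM I (\<lambda>_. jump_space)). snd (\<omega> l) \<in> B})
      \<in> sets (PiM I (\<lambda>_. jump_space :: (ennreal \<times> 's) measure))"
    by (rule sets.finite_UN[OF finite_atMost component])
  also have "(\<Union>l\<in>{..n}. {\<omega> \<in> space (PiM I (\<lambda>_. jump_space)). snd (\<omega> l) \<in> B})
      = {\<omega> \<in> space (PiM I (\<lambda>_. jump_space)). \<exists>l\<le>n. snd (\<omega> l) \<in> B}"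
    by auto
  finally show ?thesis .
qed

lemma hit_or_continue_measurable:
  "(\<lambda>\<omega>. if \<exists>l\<le>n. snd (\<omega> l) \<in> B then 1 else hit_within B k (\<omega> n))
    \<in> borel_measurable (PiM {0..<Suc n} (\<lambda>_. jump_space))"
proof (rule measurable_If)
  have "(\<lambda>\<omega>. \<omega> n) \<in> PiM {0..<Suc n} (\<lambda>_. jump_space) \<rightarrow>\<^sub>M (jump_space :: (ennreal \<times> 's) measure)"
    by (rule measurable_component_singleton) simp
  then show "(\<lambda>\<omega>. hit_within B k (\<omega> n)) \<in> borel_measurable (PiM {0..<Suc n} (\<lambda>_. jump_space))"
    by (rule measurable_compose[OF _ hit_within_measurable])
  show "{\<omega> \<in> space (PiM {0..<Suc n} (\<lambda>_. jump_space)). \<exists>l\<le>n. snd (\<omega> l) \<in> B}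
      \<in> sets (PiM {0..<Suc n} (\<lambda>_. jump_space :: (ennreal \<times> 's) measure))"
    by (rule sets_hit_prefix) (simp add: subset_eq)
qed simp

text \<open>
  The conditional probability, after \<open>m\<close> jumps, of hitting \<open>B\<close> within \<open>m + k\<close> jumps is a martingale
  in \<open>m\<close>: integrating out the last entry turns the case \<open>(Suc m, k)\<close> into \<open>(m, Suc k)\<close>.
\<close>

lemma hit_or_continue:
  "(\<integral>\<^sup>+ \<omega>. (if \<exists>l\<le>m. snd (\<omega> l) \<in> B then 1 else hit_within B k (\<omega> m)) \<partial>prefix_law i (Suc m))
    = hit_within B (m + k) (0, i)"
proof (induction m arbitrary: k)
  case 0
  have "(\<integral>\<^sup>+ \<omega>. (if \<exists>l\<le>0. snd (\<omega> l) \<in> B then 1 else hit_within B k (\<omega> 0)) \<partial>prefix_law i (Suc 0))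
      = (\<integral>\<^sup>+ \<omega>. hit_within B k (\<omega> 0) \<partial>prefix_law i (Suc 0))"
    by (intro nn_integral_cong) (auto simp: hit_within_target)
  also have "\<dots> = hit_within B k (0, i)"
    by (subst nn_integral_prefix_law_first)
      (auto intro!: measurable_compose[OF _ hit_within_measurable] measurable_component_singleton)
  finally show ?case by simp
next
  case (Suc m)
  let ?f = "\<lambda>\<omega>. if \<exists>l\<le>Suc m. snd (\<omega> l) \<in> B then 1 else hit_within B k (\<omega> (Suc m))"
  have "(\<integral>\<^sup>+ \<omega>. ?f \<omega> \<partial>prefix_law i (Suc (Suc m)))
      = (\<integral>\<^sup>+ \<omega>. \<integral>\<^sup>+ y. ?f (fun_upd \<omega> (Suc m) y) \<partial>jump_kernel r (\<omega> m) \<partial>prefix_law i (Suc m))"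
    by (rule nn_integral_prefix_law_Suc[OF hit_or_continue_measurable])
  also have "\<dots> = (\<integral>\<^sup>+ \<omega>. (if \<exists>l\<le>m. snd (\<omega> l) \<in> B then 1 else hit_within B (Suc k) (\<omega> m)) \<partial>prefix_law i (Suc m))"
  proof (intro nn_integral_cong)
    fix \<omega> :: "nat \<Rightarrow> ennreal \<times> 's"
    interpret K: prob_space "jump_kernel r (\<omega> m)" by (rule prob_space_jump_kernel)
    have "(\<exists>l\<le>Suc m. P l) \<longleftrightarrow> (\<exists>l\<le>m. P l) \<or> P (Suc m)" for P
      using le_Suc_eq by auto
    moreover have "(\<exists>l\<le>m. snd ((fun_upd \<omega> (Suc m) y) l) \<in> B) \<longleftrightarrow> (\<exists>l\<le>m. snd (\<omega> l) \<in> B)" for y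
      by (intro ex_cong1 conj_cong refl) auto
    ultimately have f: "?f (fun_upd \<omega> (Suc m) y)
        = (if (\<exists>l\<le>m. snd (\<omega> l) \<in> B) \<or> snd y \<in> B then 1 else hit_within B k y)" for y
      by (simp only: fun_upd_same)
    show "(\<integral>\<^sup>+ y. ?f (fun_upd \<omega> (Suc m) y) \<partial>jump_kernel r (\<omega> m))
        = (if \<exists>l\<le>m. snd (\<omega> l) \<in> B then 1 else hit_within B (Suc k) (\<omega> m))"
    proof (cases "\<exists>l\<le>m. snd (\<omega> l) \<in> B")
      case True
      then show ?thesis unfolding f using K.emeasure_space_1 by simp
    next
      case False
      then have "?f (fun_upd \<omega> (Suc m) y) = hit_within B k y" for y
        unfolding f by (cases "snd y \<in> B") (simp_all only: simp_thms if_True if_False hit_within_target)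
      moreover have "snd (\<omega> m) \<notin> B" using False by blast
      ultimately show ?thesis using False by (simp only: simp_thms if_False hit_within.simps)
    qed
  qed
  also have "\<dots> = hit_within B (Suc m + k) (0, i)"
    using Suc.IH[of "Suc k"] by simp
  finally show ?case .
qed

lemma emeasure_hit_prefix:
  "emeasure (jump_law r i) {\<omega> \<in> space (jump_law r i). \<exists>l\<le>n. snd (\<omega> l) \<in> B} = hit_within B n (0, i)"
proof -
  let ?f = "\<lambda>\<omega> :: nat \<Rightarrow> ennreal \<times> 's. if \<exists>l\<le>n. snd (\<omega> l) \<in> B then 1 else hit_within B 0 (\<omega> n)"
  have "{\<omega> \<in> space (jump_law r i). \<exists>l\<le>n. snd (\<omega> l) \<in> B} \<in> sets (jump_law r i)"
    unfolding sets_jump_law sets_eq_imp_space_eq[OF sets_jump_law] by (rule sets_hit_prefix[OF subset_UNIV])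
  then have "emeasure (jump_law r i) {\<omega> \<in> space (jump_law r i). \<exists>l\<le>n. snd (\<omega> l) \<in> B}
      = (\<integral>\<^sup>+ \<omega>. indicator {\<omega> \<in> space (jump_law r i). \<exists>l\<le>n. snd (\<omega> l) \<in> B} \<omega> \<partial>jump_law r i)"
    by (rule nn_integral_indicator[symmetric])
  also have "\<dots> = (\<integral>\<^sup>+ \<omega>. ?f (restrict \<omega> {0..<Suc n}) \<partial>jump_law r i)"
    by (intro nn_integral_cong) (auto simp: indicator_def less_Suc_eq_le)
  also have "\<dots> = (\<integral>\<^sup>+ \<omega>. ?f \<omega> \<partial>prefix_law i (Suc n))"
    by (rule nn_integral_jump_law_prefix[OF hit_or_continue_measurable])
  also have "\<dots> = hit_within B n (0, i)"
    by (simp only: hit_or_continue add_0_right)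
  finally show ?thesis .
qed

lemma hit_probability_jump_law:
  "measure (jump_law r i) {\<omega> \<in> space (jump_law r i). hitting_time B \<omega> < \<infinity>}
    = enn2real (SUP n. hit_within B n (0, i))"
proof -
  interpret prob_space "jump_law r i" by (rule prob_space_jump_law)
  have hit: "{\<omega> \<in> space (jump_law r i). hitting_time B \<omega> < \<infinity>} \<in> sets (jump_law r i)"
    by (rule hitting_time_measurable) simp
  define E where "E n = {\<omega> \<in> space (jump_law r i). \<exists>l\<le>n. snd (\<omega> l) \<in> B}" for n
  have E: "range E \<subseteq> sets (jump_law r i)"
  proof (rule image_subsetI)
    fix n show "E n \<in> sets (jump_law r i)"
      unfolding E_def sets_jump_law sets_eq_imp_space_eq[OF sets_jump_law]
      by (rule sets_hit_prefix[OF subset_UNIV])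
  qed
  have "incseq E" unfolding E_def incseq_def by (blast intro: order_trans)
  have "AE \<omega> in jump_law r i. \<forall>n. regular_step (\<omega> n) (\<omega> (Suc n))"
    using AE_jump_law_regular by (simp add: AE_all_countable)
  then have "AE \<omega> in jump_law r i. hitting_time B \<omega> < \<infinity> \<longleftrightarrow> (\<exists>n. snd (\<omega> n) \<in> B)"
    using AE_jump_law_start by eventually_elim (rule regular_path_hits_iff, auto)
  then have "AE \<omega> in jump_law r i.
      \<omega> \<in> {\<omega> \<in> space (jump_law r i). hitting_time B \<omega> < \<infinity>} \<longleftrightarrow> \<omega> \<in> (\<Union>n. E n)"
    using AE_space by eventually_elim (unfold E_def, blast)
  then have "emeasure (jump_law r i) {\<omega> \<in> space (jump_law r i). hitting_time B \<omega> < \<infinity>}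
      = emeasure (jump_law r i) (\<Union>n. E n)"
    using hit sets.countable_UN[OF E] by (rule emeasure_eq_AE)
  also have "\<dots> = (SUP n. emeasure (jump_law r i) (E n))"
    by (rule SUP_emeasure_incseq[symmetric, OF E \<open>incseq E\<close>])
  also have "\<dots> = (SUP n. hit_within B n (0, i))"
    by (simp only: E_def emeasure_hit_prefix)
  finally show ?thesis by (simp add: measure_def)
qed

end

text \<open>
  Jump times are positive, so the law only depends on the rates at nonnegative times.
\<close>

lemma jump_law_cong:
  assumes eq: "\<And>i j t. 0 \<le> t \<Longrightarrow> r j i t = r' j i t"
  shows "jump_law r = jump_law r'"
proof -
  have "(LINT u:{enn2real s..t}|lborel. - r i i u) = (LINT u:{enn2real s..t}|lborel. - r' i i u)" for s t i
    using eq order_trans[OF enn2real_nonneg[of s]] by (intro set_lebesgue_integral_cong) auto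
  moreover have "r j i t = r' j i t" if "s < ennreal t" for s i j t
  proof (rule eq)
    have "0 < ennreal t" using le_less_trans[OF zero_le that] .
    then show "0 \<le> t" by simp
  qed
  ultimately have "jump_density r = jump_density r'"
    by (intro ext) (auto simp: jump_density_def)
  then have "jump_kernel r = jump_kernel r'"
    by (intro ext) (simp add: jump_kernel_def finite_jump_law_def)
  then have "jump_step r = jump_step r'"
    by (intro ext, rename_tac i n \<omega>) (case_tac n, auto)
  then show ?thesis by (intro ext) (simp add: jump_law_def)
qed

section \<open>Value iteration\<close>

lemma nn_integral_count_space_infsum:
  fixes f :: "'b \<Rightarrow> real"
  assumes nonneg: "\<And>j. j \<in> I \<Longrightarrow> 0 \<le> f j" and summable: "f summable_on I"
  shows "(\<integral>\<^sup>+ j. ennreal (f j) \<partial>count_space I) = ennreal (\<Sum>\<^sub>\<infinity>j\<in>I. f j)"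
proof -
  have "(\<lambda>j. norm (f j)) summable_on I"
    using summable nonneg by (subst summable_on_cong[where g = f]) auto
  then have "Infinite_Set_Sum.abs_summable_on f I" by (rule abs_summable_equivalent[THEN iffD1])
  then show ?thesis using nonneg by (simp add: nn_integral_conv_infsetsum infsetsum_infsum)
qed

context controlled_system
begin

lemma off_diagonal_has_sum:
  assumes "a \<in> A i"
  shows "((\<lambda>j. if j = i then 0 else q j i a) has_sum exit_rate q i a) UNIV"
proof -
  have "((\<lambda>j. q j i a + (if j = i then - q i i a else 0)) has_sum (0 + - q i i a)) UNIV"
    by (intro has_sum_add conservative[OF assms])
      (use has_sum_finite_neutralI[of "{i}" UNIV "\<lambda>j. if j = i then - q i i a else 0"] in simp)
  moreover have "(\<lambda>j. q j i a + (if j = i then - q i i a else 0)) = (\<lambda>j. if j = i then 0 else q j i a)"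
    by auto
  ultimately show ?thesis by (simp add: exit_rate_def)
qed

lemma exit_rate_nonneg:
  assumes "a \<in> A i"
  shows "0 \<le> exit_rate q i a"
  using has_sum_nonneg[OF off_diagonal_has_sum[OF assms]] rate_nonneg[OF assms] by auto

text \<open>
  The off-diagonal part of the generator under action \<open>a\<close>, applied to \<open>v\<close>. Working in extended
  nonnegative reals avoids all summability conditions.
\<close>

definition inflow :: "('s \<Rightarrow> ennreal) \<Rightarrow> 's \<Rightarrow> 'a \<Rightarrow> ennreal" where
  "inflow v i a = (\<integral>\<^sup>+ j. (if j = i then 0 else ennreal (q j i a)) * v j \<partial>count_space UNIV)"

text \<open>
  The expectation of \<open>v\<close> after one jump out of \<open>i\<close> under action \<open>a\<close>. The factor is inverted before
  the embedding into the extended reals, which keeps cancellation with the exit rate within the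
  reals.
\<close>

definition lookahead :: "('s \<Rightarrow> ennreal) \<Rightarrow> 's \<Rightarrow> 'a \<Rightarrow> ennreal" where
  "lookahead v i a = ennreal (1 / exit_rate q i a) * inflow v i a"

lemma inflow_mono: "(\<And>j. v j \<le> w j) \<Longrightarrow> inflow v i a \<le> inflow w i a"
  unfolding inflow_def by (intro nn_integral_mono mult_left_mono) auto

lemma lookahead_mono: "(\<And>j. v j \<le> w j) \<Longrightarrow> lookahead v i a \<le> lookahead w i a"
  unfolding lookahead_def by (intro mult_left_mono inflow_mono) auto

lemma inflow_real:
  assumes a: "a \<in> A i" and x: "\<And>j. 0 \<le> x j" "\<And>j. x j \<le> 1"
  shows "(\<lambda>j. (if j = i then 0 else q j i a) * x j) summable_on UNIV"
    and "inflow (\<lambda>j. ennreal (x j)) i a = ennreal (\<Sum>\<^sub>\<infinity>j. (if j = i then 0 else q j i a) * x j)"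
proof -
  have nonneg: "0 \<le> (if j = i then 0 else q j i a)" for j
    using rate_nonneg[OF a] by auto
  show summable: "(\<lambda>j. (if j = i then 0 else q j i a) * x j) summable_on UNIV"
  proof (rule summable_on_comparison_test)
    show "(\<lambda>j. if j = i then 0 else q j i a) summable_on UNIV"
      using off_diagonal_has_sum[OF a] by (rule has_sum_imp_summable)
    show "(if j = i then 0 else q j i a) * x j \<le> (if j = i then 0 else q j i a)" for j
      using mult_left_mono[OF x(2) nonneg] by simp
  qed (use nonneg x in auto)
  have "inflow (\<lambda>j. ennreal (x j)) i a
      = (\<integral>\<^sup>+ j. ennreal ((if j = i then 0 else q j i a) * x j) \<partial>count_space UNIV)"
    unfolding inflow_def using nonneg x
    by (intro nn_integral_cong) (auto simp: ennreal_mult rate_nonneg[OF a])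
  also have "\<dots> = ennreal (\<Sum>\<^sub>\<infinity>j. (if j = i then 0 else q j i a) * x j)"
    using nonneg x summable by (intro nn_integral_count_space_infsum) auto
  finally show "inflow (\<lambda>j. ennreal (x j)) i a = \<dots>" .
qed

lemma inflow_one:
  assumes "a \<in> A i"
  shows "inflow (\<lambda>_. 1) i a = ennreal (exit_rate q i a)"
  using inflow_real(2)[OF assms, of "\<lambda>_. 1"] infsumI[OF off_diagonal_has_sum[OF assms]] by simp

lemma exit_rate_times_lookahead:
  assumes "i \<notin> B" "a \<in> A i"
  shows "ennreal (exit_rate q i a) * lookahead v i a = inflow v i a"
  using exit_rate_pos[OF assms]
  by (simp add: lookahead_def mult.assoc[symmetric] ennreal_mult[symmetric])

lemma lookahead_le_1:
  assumes "i \<notin> B" "a \<in> A i" "\<And>j. v j \<le> 1"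
  shows "lookahead v i a \<le> 1"
proof -
  have "lookahead v i a \<le> ennreal (1 / exit_rate q i a) * ennreal (exit_rate q i a)"
    unfolding lookahead_def inflow_one[OF assms(2), symmetric]
    by (intro mult_left_mono inflow_mono assms) auto
  also have "\<dots> = 1" using exit_rate_pos[OF assms(1,2)] by (simp add: ennreal_mult[symmetric])
  finally show ?thesis .
qed

lemma lookahead_SUP:
  assumes "incseq v"
  shows "lookahead (\<lambda>j. SUP n. v n j) i a = (SUP n. lookahead (v n) i a)"
proof -
  have mono: "incseq (\<lambda>n. v n j)" for j
    using assms by (auto simp: incseq_def le_fun_def)
  have "inflow (\<lambda>j. SUP n. v n j) i a
      = (\<integral>\<^sup>+ j. (SUP n. (if j = i then 0 else ennreal (q j i a)) * v n j) \<partial>count_space UNIV)"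
    unfolding inflow_def by (simp only: SUP_mult_left_ennreal)
  also have "\<dots> = (SUP n. inflow (v n) i a)"
    unfolding inflow_def
    by (intro nn_integral_monotone_convergence_SUP)
      (use mono in \<open>auto simp: incseq_def le_fun_def intro!: mult_left_mono\<close>)
  finally show ?thesis unfolding lookahead_def by (simp only: SUP_mult_left_ennreal)
qed

primrec value_iterate :: "nat \<Rightarrow> 's \<Rightarrow> ennreal" where
  "value_iterate 0 = indicator B"
| "value_iterate (Suc n) =
     (\<lambda>i. if i \<in> B then 1 else Min (lookahead (value_iterate n) i ` A i))"

definition optimal_value :: "'s \<Rightarrow> ennreal" where
  "optimal_value i = (SUP n. value_iterate n i)"

lemma value_iterate_target: "i \<in> B \<Longrightarrow> value_iterate n i = 1"
  by (cases n) auto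

lemma Min_lookahead_le: "a \<in> A i \<Longrightarrow> Min (lookahead v i ` A i) \<le> lookahead v i a"
  by (intro Min_le) (auto simp: finite_actions)

lemma value_iterate_le_1: "value_iterate n i \<le> 1"
proof (induction n arbitrary: i)
  case 0
  show ?case by (simp add: indicator_def)
next
  case (Suc n)
  obtain a where "a \<in> A i" using actions_nonempty by blast
  then show ?case
    using Min_lookahead_le[of a i "value_iterate n"] lookahead_le_1[of i a "value_iterate n"] Suc.IH
    by (auto intro: order_trans)
qed

lemma incseq_value_iterate: "incseq value_iterate"
proof (rule incseq_SucI)
  fix n show "value_iterate n \<le> value_iterate (Suc n)"
  proof (induction n)
    case 0
    show ?case by (simp add: le_fun_def indicator_def)
  next
    case (Suc n)
    show ?case
    proof (rule le_funI)
      fix i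
      show "value_iterate (Suc n) i \<le> value_iterate (Suc (Suc n)) i"
      proof (cases "i \<in> B")
        case False
        have "Min (lookahead (value_iterate n) i ` A i) \<le> lookahead (value_iterate (Suc n)) i a"
          if "a \<in> A i" for a
          by (rule order_trans[OF Min_lookahead_le[OF that] lookahead_mono]) (rule le_funD[OF Suc.IH])
        then have "Min (lookahead (value_iterate n) i ` A i)
            \<le> Min (lookahead (value_iterate (Suc n)) i ` A i)"
          by (intro Min.boundedI) (auto simp: finite_actions actions_nonempty)
        with False show ?thesis by simp
      qed simp
    qed
  qed
qed

lemma optimal_value_target: "i \<in> B \<Longrightarrow> optimal_value i = 1"
  by (simp add: optimal_value_def value_iterate_target)

lemma optimal_value_le_1: "optimal_value i \<le> 1"
  unfolding optimal_value_def by (intro SUP_least value_iterate_le_1)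

lemma lookahead_optimal_value: "lookahead optimal_value i a = (SUP n. lookahead (value_iterate n) i a)"
  using lookahead_SUP[OF incseq_value_iterate] by (simp add: optimal_value_def[abs_def])

text \<open>
  Each iterate is a minimum over the actions, hence below the lookahead of the preceding iterate, and
  this one increases to the lookahead of the limit.
\<close>

lemma optimal_value_le_lookahead:
  assumes "i \<notin> B" "a \<in> A i"
  shows "optimal_value i \<le> lookahead optimal_value i a"
  unfolding optimal_value_def[of i]
proof (rule SUP_least)
  fix n
  show "value_iterate n i \<le> lookahead optimal_value i a"
  proof (cases n)
    case (Suc m)
    have "value_iterate n i \<le> lookahead (value_iterate m) i a"
      using assms Min_lookahead_le[of a i] by (simp add: Suc)
    also have "\<dots> \<le> lookahead optimal_value i a"
      unfolding lookahead_optimal_value by (rule SUP_upper) simp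
    finally show ?thesis .
  qed (use assms in simp)
qed

text \<open>
  If no action attained the optimal value, then for each action some iterate would already have a
  larger lookahead; as there are finitely many actions and the iterates increase, one iterate would
  serve for all of them, and the next iterate would exceed the limit.
\<close>

lemma optimal_action_exists:
  assumes "i \<notin> B"
  shows "\<exists>a\<in>A i. lookahead optimal_value i a = optimal_value i"
proof (rule ccontr)
  assume "\<not> ?thesis"
  then have less: "optimal_value i < lookahead optimal_value i a" if "a \<in> A i" for a
    using that optimal_value_le_lookahead[OF assms that] by (auto simp: less_le)
  have "\<forall>\<^sub>F n in sequentially. optimal_value i < lookahead (value_iterate n) i a" if a: "a \<in> A i" for a
  proof -
    obtain m where m: "optimal_value i < lookahead (value_iterate m) i a"
      using less[OF a] unfolding lookahead_optimal_value less_SUP_iff by blast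
    show ?thesis
    proof (rule eventually_sequentiallyI)
      fix n assume "m \<le> n"
      then have "lookahead (value_iterate m) i a \<le> lookahead (value_iterate n) i a"
        using incseqD[OF incseq_value_iterate] by (intro lookahead_mono) (auto simp: le_fun_def)
      with m show "optimal_value i < lookahead (value_iterate n) i a" by simp
    qed
  qed
  then have "\<forall>\<^sub>F n in sequentially. \<forall>a\<in>A i. optimal_value i < lookahead (value_iterate n) i a"
    by (intro eventually_ball_finite finite_actions) auto
  then obtain n where "\<forall>a\<in>A i. optimal_value i < lookahead (value_iterate n) i a"
    by (auto simp: eventually_sequentially)
  then have "optimal_value i < value_iterate (Suc n) i"
    using assms finite_actions actions_nonempty by (simp add: Min_gr_iff)
  also have "\<dots> \<le> optimal_value i"
    unfolding optimal_value_def by (rule SUP_upper) simp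
  finally show False by simp
qed

text \<open>
  The optimal value is \<open>1\<close> on \<open>B\<close>, which accounts for the separate sum over \<open>B\<close> in the
  optimality equation.
\<close>

lemma one_step_value_eq_lookahead:
  assumes i: "i \<notin> B" and a: "a \<in> A i"
  shows "one_step_value B q (\<lambda>k. enn2real (optimal_value k)) i a = enn2real (lookahead optimal_value i a)"
proof -
  define x where "x k = enn2real (optimal_value k)" for k
  have fin: "optimal_value k < \<infinity>" for k
    using optimal_value_le_1[of k] by (simp add: le_less_trans)
  have x: "0 \<le> x k" "x k \<le> 1" for k
    using optimal_value_le_1[of k] fin[of k] by (auto simp: x_def enn2real_leI)
  have v: "optimal_value = (\<lambda>k. ennreal (x k))"
    using fin by (auto simp: x_def fun_eq_iff)
  define g where "g k = (if k = i then 0 else q k i a) * x k" for k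
  have g: "g summable_on UNIV" "inflow optimal_value i a = ennreal (\<Sum>\<^sub>\<infinity>k. g k)"
    using inflow_real[OF a x] by (auto simp: v g_def[abs_def])
  have "(\<Sum>\<^sub>\<infinity>k. g k) = (\<Sum>\<^sub>\<infinity>k\<in>B \<union> - B. g k)" by simp
  also have "\<dots> = (\<Sum>\<^sub>\<infinity>k\<in>B. g k) + (\<Sum>\<^sub>\<infinity>k\<in>- B. g k)"
    using g(1) by (intro infsum_Un_disjoint) (auto intro: summable_on_subset_banach)
  also have "(\<Sum>\<^sub>\<infinity>k\<in>B. g k) = (\<Sum>k\<in>B. q k i a)"
    using i finite_target by (auto simp: g_def x_def optimal_value_target intro!: sum.cong)
  also have "(\<Sum>\<^sub>\<infinity>k\<in>- B. g k) = (\<Sum>\<^sub>\<infinity>k\<in>- B - {i}. q k i a * x k)"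
    by (rule infsum_cong_neutral) (auto simp: g_def)
  finally have sum: "(\<Sum>\<^sub>\<infinity>k. g k) = (\<Sum>k\<in>B. q k i a) + (\<Sum>\<^sub>\<infinity>k\<in>- B - {i}. q k i a * x k)" .
  have "0 \<le> (\<Sum>\<^sub>\<infinity>k. g k)"
    using rate_nonneg[OF a] x by (intro infsum_nonneg) (auto simp: g_def)
  then have "enn2real (lookahead optimal_value i a) = (1 / exit_rate q i a) * (\<Sum>\<^sub>\<infinity>k. g k)"
    using exit_rate_pos[OF i a] by (simp add: lookahead_def g enn2real_mult)
  then show ?thesis by (simp add: one_step_value_def sum x_def)
qed

section \<open>One jump under a Markov policy\<close>

definition positive_time_rate :: "('s, 'a) policy \<Rightarrow> 's \<Rightarrow> 's \<Rightarrow> real \<Rightarrow> real" where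
  "positive_time_rate \<pi> j i t = (if t \<in> {0..} then policy_rate A q \<pi> j i t else 0)"

lemma policy_pmf_sum:
  assumes "\<pi> \<in> markov_policies A" "0 \<le> t"
  shows "(\<Sum>a\<in>A i. pmf (\<pi> t i) a) = 1"
  using assms by (simp add: markov_policies_def measure_measure_pmf_finite[OF finite_actions, symmetric])

lemma policy_exit_rate:
  "- policy_rate A q \<pi> i i t = (\<Sum>a\<in>A i. exit_rate q i a * pmf (\<pi> t i) a)"
  by (simp add: policy_rate_def exit_rate_def sum_negf)

text \<open>
  The rate out of \<open>i\<close> under a randomized policy is a mixture over the actions; this is what reduces
  the time-dependent kernel to the lookahead of single actions.
\<close>

lemma policy_inflow:
  assumes "0 \<le> t"
  shows "(\<integral>\<^sup>+ j. (if j = i then 0 else ennreal (positive_time_rate \<pi> j i t)) * g j \<partial>count_space UNIV)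
    = (\<Sum>a\<in>A i. ennreal (pmf (\<pi> t i) a) * inflow g i a)"
proof -
  have "(if j = i then 0 else ennreal (positive_time_rate \<pi> j i t)) * g j
      = (\<Sum>a\<in>A i. ennreal (pmf (\<pi> t i) a) * ((if j = i then 0 else ennreal (q j i a)) * g j))" for j
  proof (cases "j = i")
    case False
    have "ennreal (positive_time_rate \<pi> j i t) = (\<Sum>a\<in>A i. ennreal (q j i a * pmf (\<pi> t i) a))"
      using assms False rate_nonneg
      by (simp add: positive_time_rate_def policy_rate_def sum_ennreal)
    also have "\<dots> = (\<Sum>a\<in>A i. ennreal (pmf (\<pi> t i) a) * ennreal (q j i a))"
      using False rate_nonneg by (intro sum.cong) (auto simp: ennreal_mult mult.commute)
    finally show ?thesis using False by (simp add: sum_distrib_right mult.assoc)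
  qed simp
  then show ?thesis
    by (simp add: inflow_def nn_integral_sum nn_integral_cmult)
qed

lemma policy_exit_rate_ennreal:
  assumes "0 \<le> t"
  shows "ennreal (- positive_time_rate \<pi> i i t)
    = (\<Sum>a\<in>A i. ennreal (pmf (\<pi> t i) a) * ennreal (exit_rate q i a))"
proof -
  have "ennreal (- positive_time_rate \<pi> i i t) = (\<Sum>a\<in>A i. ennreal (exit_rate q i a * pmf (\<pi> t i) a))"
    using assms exit_rate_nonneg
    by (simp add: positive_time_rate_def policy_exit_rate sum_ennreal)
  also have "\<dots> = (\<Sum>a\<in>A i. ennreal (pmf (\<pi> t i) a) * ennreal (exit_rate q i a))"
    using exit_rate_nonneg by (intro sum.cong) (auto simp: ennreal_mult mult.commute)
  finally show ?thesis .
qed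

lemma exit_rate_le_max: "a \<in> A i \<Longrightarrow> exit_rate q i a \<le> max_exit_rate A q i"
  unfolding max_exit_rate_def by (intro Max_ge) (auto simp: finite_actions)

lemma positive_time_rate_measurable:
  assumes "\<pi> \<in> markov_policies A"
  shows "positive_time_rate \<pi> j i \<in> borel_measurable borel"
proof -
  have [measurable]: "(\<lambda>t. pmf (\<pi> t i) a) \<in> borel_measurable (restrict_space borel {0..})" if "a \<in> A i" for a
  proof -
    have "(\<lambda>t. measure_pmf.prob (\<pi> t i) {a}) \<in> borel_measurable (restrict_space borel {0..})"
      using assms that by (auto simp: markov_policies_def)
    then show ?thesis by (simp add: measure_pmf_single)
  qed
  have "policy_rate A q \<pi> j i \<in> borel_measurable (restrict_space borel {0..})"
    unfolding policy_rate_def[abs_def] by (intro borel_measurable_sum borel_measurable_times) auto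
  then have "(\<lambda>t. if t \<in> {0..} then policy_rate A q \<pi> j i t else 0) \<in> borel_measurable borel"
    by (subst measurable_restrict_space_iff[symmetric]) auto
  then show ?thesis by (simp add: positive_time_rate_def[abs_def])
qed

lemma jump_rates_policy:
  assumes "\<pi> \<in> markov_policies A"
  shows "jump_rates (positive_time_rate \<pi>) (max_exit_rate A q)"
proof
  fix i j :: 's and t :: real
  show "positive_time_rate \<pi> j i \<in> borel_measurable borel"
    by (rule positive_time_rate_measurable[OF assms])
  show "0 \<le> positive_time_rate \<pi> j i t" if "j \<noteq> i"
    using that rate_nonneg by (auto simp: positive_time_rate_def policy_rate_def intro!: sum_nonneg)
  show "0 \<le> - positive_time_rate \<pi> i i t"
  proof (cases "0 \<le> t")
    case True
    then show ?thesis
      using exit_rate_nonneg unfolding positive_time_rate_def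
      by (simp add: policy_exit_rate sum_nonneg del: neg_0_le_iff_le)
  qed (simp add: positive_time_rate_def)
  obtain a where a: "a \<in> A i" using actions_nonempty by blast
  show "- positive_time_rate \<pi> i i t \<le> max_exit_rate A q i"
  proof (cases "0 \<le> t")
    case True
    have "- positive_time_rate \<pi> i i t = (\<Sum>a\<in>A i. exit_rate q i a * pmf (\<pi> t i) a)"
      using True by (simp add: positive_time_rate_def policy_exit_rate)
    also have "\<dots> \<le> (\<Sum>a\<in>A i. max_exit_rate A q i * pmf (\<pi> t i) a)"
      by (intro sum_mono mult_right_mono exit_rate_le_max) auto
    also have "\<dots> = max_exit_rate A q i"
      by (simp add: sum_distrib_left[symmetric] policy_pmf_sum[OF assms True])
    finally show ?thesis .
  next
    case False
    then show ?thesis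
      using order_trans[OF exit_rate_nonneg[OF a] exit_rate_le_max[OF a]] by (simp add: positive_time_rate_def)
  qed
  show "(\<integral>\<^sup>+ j. (if j = i then 0 else ennreal (positive_time_rate \<pi> j i t)) \<partial>count_space UNIV)
      = ennreal (- positive_time_rate \<pi> i i t)"
  proof (cases "0 \<le> t")
    case True
    then show ?thesis
      using policy_inflow[OF True, of i \<pi> "\<lambda>_. 1"] by (simp add: policy_exit_rate_ennreal inflow_one)
  next
    case False
    then have "(if j = i then 0 else ennreal (positive_time_rate \<pi> j i t)) = 0" for j
      by (simp add: positive_time_rate_def)
    with False show ?thesis by (simp add: positive_time_rate_def)
  qed
qed

lemma policy_exit_rate_bounded_below:
  assumes "\<pi> \<in> markov_policies A" "i \<notin> B"
  shows "\<exists>e>0. \<forall>t\<ge>0. e \<le> - positive_time_rate \<pi> i i t"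
proof (intro exI conjI allI impI)
  let ?e = "Min (exit_rate q i ` A i)"
  show "0 < ?e"
    using assms(2) exit_rate_pos finite_actions actions_nonempty by simp
  fix t :: real assume t: "0 \<le> t"
  have "?e = (\<Sum>a\<in>A i. ?e * pmf (\<pi> t i) a)"
    by (simp add: sum_distrib_left[symmetric] policy_pmf_sum[OF assms(1) t])
  also have "\<dots> \<le> (\<Sum>a\<in>A i. exit_rate q i a * pmf (\<pi> t i) a)"
    by (intro sum_mono mult_right_mono Min_le) (auto simp: finite_actions)
  also have "\<dots> = - positive_time_rate \<pi> i i t"
    using t by (simp add: positive_time_rate_def policy_exit_rate)
  finally show "?e \<le> - positive_time_rate \<pi> i i t" .
qed

abbreviation policy_kernel :: "('s, 'a) policy \<Rightarrow> ennreal \<times> 's \<Rightarrow> (ennreal \<times> 's) measure" where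
  "policy_kernel \<pi> \<equiv> jump_kernel (positive_time_rate \<pi>)"

text \<open>
  The integrand of the second equation is the density of the jump time, which has mass \<open>1\<close> because
  the exit rate is bounded away from \<open>0\<close>. It is written as a sum over the actions, so that the two
  integrals can be compared action by action.
\<close>

lemma policy_kernel_outside_target:
  assumes pol: "\<pi> \<in> markov_policies A" and i: "i \<notin> B" and s: "0 \<le> s"
    and f: "f \<in> borel_measurable jump_space"
  shows "(\<integral>\<^sup>+ y. f y \<partial>policy_kernel \<pi> (ennreal s, i))
      = (\<integral>\<^sup>+ t. indicator {s<..} t * ennreal (jump_rates.survival (positive_time_rate \<pi>) i s t) *
          (\<Sum>a\<in>A i. ennreal (pmf (\<pi> t i) a) * inflow (\<lambda>j. f (ennreal t, j)) i a) \<partial>lborel)"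
    and "(\<integral>\<^sup>+ t. indicator {s<..} t * ennreal (jump_rates.survival (positive_time_rate \<pi>) i s t) *
          (\<Sum>a\<in>A i. ennreal (pmf (\<pi> t i) a) * ennreal (exit_rate q i a)) \<partial>lborel) = 1"
proof -
  interpret jump_rates "positive_time_rate \<pi>" "max_exit_rate A q"
    by (rule jump_rates_policy[OF pol])
  obtain e where "0 < e" "\<And>t. 0 \<le> t \<Longrightarrow> e \<le> - positive_time_rate \<pi> i i t"
    using policy_exit_rate_bounded_below[OF pol i] by blast
  then have mass: "emeasure (finite_jump_law (positive_time_rate \<pi>) (ennreal s, i)) UNIV = 1"
    by (rule finite_jump_law_mass_eq_1[OF s])
  have integral: "(\<integral>\<^sup>+ y. g y \<partial>finite_jump_law (positive_time_rate \<pi>) (ennreal s, i))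
      = (\<integral>\<^sup>+ t. indicator {s<..} t * ennreal (survival i s t) *
          (\<Sum>a\<in>A i. ennreal (pmf (\<pi> t i) a) * inflow (\<lambda>j. g (ennreal t, j)) i a) \<partial>lborel)"
    if "g \<in> borel_measurable jump_space" for g
    unfolding finite_jump_law_iterated[OF s that]
  proof (rule nn_integral_cong)
    fix t :: real
    show "indicator {s<..} t * ennreal (survival i s t) *
          (\<integral>\<^sup>+ j. (if j = i then 0 else ennreal (positive_time_rate \<pi> j i t)) * g (ennreal t, j) \<partial>count_space UNIV)
        = indicator {s<..} t * ennreal (survival i s t) *
          (\<Sum>a\<in>A i. ennreal (pmf (\<pi> t i) a) * inflow (\<lambda>j. g (ennreal t, j)) i a)"
      using s policy_inflow[of t i \<pi> "\<lambda>j. g (ennreal t, j)"] by (cases "s < t") auto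
  qed
  show "(\<integral>\<^sup>+ y. f y \<partial>policy_kernel \<pi> (ennreal s, i))
      = (\<integral>\<^sup>+ t. indicator {s<..} t * ennreal (survival i s t) *
          (\<Sum>a\<in>A i. ennreal (pmf (\<pi> t i) a) * inflow (\<lambda>j. f (ennreal t, j)) i a) \<partial>lborel)"
    unfolding jump_kernel_eq_finite_jump_law[OF mass] by (rule integral[OF f])
  show "(\<integral>\<^sup>+ t. indicator {s<..} t * ennreal (survival i s t) *
          (\<Sum>a\<in>A i. ennreal (pmf (\<pi> t i) a) * ennreal (exit_rate q i a)) \<partial>lborel) = 1"
    using integral[of "\<lambda>_. 1"] mass by (simp add: inflow_one)
qed

lemma survival_times_actions_measurable:
  assumes pol: "\<pi> \<in> markov_policies A" and s: "0 \<le> s"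
  shows "(\<lambda>t. indicator {s<..} t * ennreal (jump_rates.survival (positive_time_rate \<pi>) i s t) *
      (\<Sum>a\<in>A i. ennreal (pmf (\<pi> t i) a) * ennreal (exit_rate q i a))) \<in> borel_measurable lborel"
proof -
  interpret jump_rates "positive_time_rate \<pi>" "max_exit_rate A q"
    by (rule jump_rates_policy[OF pol])
  have "(\<lambda>t. indicator {s<..} t * ennreal (survival i s t) * ennreal (- positive_time_rate \<pi> i i t))
      \<in> borel_measurable lborel"
    by measurable
  also have "(\<lambda>t. indicator {s<..} t * ennreal (survival i s t) * ennreal (- positive_time_rate \<pi> i i t))
    = (\<lambda>t. indicator {s<..} t * ennreal (survival i s t) *
      (\<Sum>a\<in>A i. ennreal (pmf (\<pi> t i) a) * ennreal (exit_rate q i a)))"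
    using s by (auto simp: fun_eq_iff indicator_def policy_exit_rate_ennreal)
  finally show ?thesis .
qed

text \<open>
  With \<open>w\<close> written as an integral of \<open>w\<close> against the total mass \<open>1\<close> of the jump time, it
  suffices to compare integrands, and there action by action.
\<close>

lemma policy_kernel_ge:
  assumes pol: "\<pi> \<in> markov_policies A" and i: "i \<notin> B" and s: "0 \<le> s"
    and f: "f \<in> borel_measurable jump_space"
    and le: "\<And>t a. 0 \<le> t \<Longrightarrow> a \<in> A i \<Longrightarrow> w \<le> lookahead (\<lambda>j. f (ennreal t, j)) i a"
  shows "w \<le> (\<integral>\<^sup>+ y. f y \<partial>policy_kernel \<pi> (ennreal s, i))"
proof -
  let ?S = "\<lambda>t. indicator {s<..} t * ennreal (jump_rates.survival (positive_time_rate \<pi>) i s t)"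
  have "w = (\<integral>\<^sup>+ t. ?S t * (\<Sum>a\<in>A i. ennreal (pmf (\<pi> t i) a) * ennreal (exit_rate q i a)) * w \<partial>lborel)"
    by (simp only: nn_integral_multc[OF survival_times_actions_measurable[OF pol s]]
        policy_kernel_outside_target(2)[OF pol i s f] mult_1)
  also have "\<dots> \<le> (\<integral>\<^sup>+ t. ?S t *
      (\<Sum>a\<in>A i. ennreal (pmf (\<pi> t i) a) * inflow (\<lambda>j. f (ennreal t, j)) i a) \<partial>lborel)"
  proof (rule nn_integral_mono)
    fix t :: real
    have "(\<Sum>a\<in>A i. ennreal (pmf (\<pi> t i) a) * ennreal (exit_rate q i a)) * w
        \<le> (\<Sum>a\<in>A i. ennreal (pmf (\<pi> t i) a) * inflow (\<lambda>j. f (ennreal t, j)) i a)" if "s < t"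
      unfolding sum_distrib_right mult.assoc
    proof (intro sum_mono mult_left_mono)
      fix a assume "a \<in> A i"
      then show "ennreal (exit_rate q i a) * w \<le> inflow (\<lambda>j. f (ennreal t, j)) i a"
        using le[of t a] that s unfolding exit_rate_times_lookahead[OF i \<open>a \<in> A i\<close>, symmetric]
        by (intro mult_left_mono) auto
    qed simp
    then show "?S t * (\<Sum>a\<in>A i. ennreal (pmf (\<pi> t i) a) * ennreal (exit_rate q i a)) * w
        \<le> ?S t * (\<Sum>a\<in>A i. ennreal (pmf (\<pi> t i) a) * inflow (\<lambda>j. f (ennreal t, j)) i a)"
      by (cases "s < t") (auto simp: mult.assoc intro!: mult_left_mono)
  qed
  also have "\<dots> = (\<integral>\<^sup>+ y. f y \<partial>policy_kernel \<pi> (ennreal s, i))"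
    by (rule policy_kernel_outside_target(1)[OF pol i s f, symmetric])
  finally show ?thesis .
qed

text \<open>
  The converse comparison. Only actions that the policy uses need to be bounded, which is essential for
  a stationary policy.
\<close>

lemma policy_kernel_le:
  assumes pol: "\<pi> \<in> markov_policies A" and i: "i \<notin> B" and s: "0 \<le> s"
    and f: "f \<in> borel_measurable jump_space"
    and ge: "\<And>t a. 0 \<le> t \<Longrightarrow> a \<in> A i \<Longrightarrow> a \<in> set_pmf (\<pi> t i) \<Longrightarrow> lookahead (\<lambda>j. f (ennreal t, j)) i a \<le> w"
  shows "(\<integral>\<^sup>+ y. f y \<partial>policy_kernel \<pi> (ennreal s, i)) \<le> w"
proof -
  let ?S = "\<lambda>t. indicator {s<..} t * ennreal (jump_rates.survival (positive_time_rate \<pi>) i s t)"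
  have "(\<integral>\<^sup>+ y. f y \<partial>policy_kernel \<pi> (ennreal s, i)) = (\<integral>\<^sup>+ t. ?S t *
      (\<Sum>a\<in>A i. ennreal (pmf (\<pi> t i) a) * inflow (\<lambda>j. f (ennreal t, j)) i a) \<partial>lborel)"
    by (rule policy_kernel_outside_target(1)[OF pol i s f])
  also have "\<dots> \<le> (\<integral>\<^sup>+ t. ?S t * (\<Sum>a\<in>A i. ennreal (pmf (\<pi> t i) a) * ennreal (exit_rate q i a)) * w \<partial>lborel)"
  proof (rule nn_integral_mono)
    fix t :: real
    have "(\<Sum>a\<in>A i. ennreal (pmf (\<pi> t i) a) * inflow (\<lambda>j. f (ennreal t, j)) i a)
        \<le> (\<Sum>a\<in>A i. ennreal (pmf (\<pi> t i) a) * ennreal (exit_rate q i a)) * w" if "s < t"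
      unfolding sum_distrib_right mult.assoc
    proof (intro sum_mono)
      fix a assume a: "a \<in> A i"
      show "ennreal (pmf (\<pi> t i) a) * inflow (\<lambda>j. f (ennreal t, j)) i a
          \<le> ennreal (pmf (\<pi> t i) a) * (ennreal (exit_rate q i a) * w)"
      proof (cases "a \<in> set_pmf (\<pi> t i)")
        case True
        then show ?thesis
          using ge[of t a] a that s unfolding exit_rate_times_lookahead[OF i a, symmetric]
          by (intro mult_left_mono) auto
      qed (simp add: set_pmf_iff)
    qed
    then show "?S t * (\<Sum>a\<in>A i. ennreal (pmf (\<pi> t i) a) * inflow (\<lambda>j. f (ennreal t, j)) i a)
        \<le> ?S t * (\<Sum>a\<in>A i. ennreal (pmf (\<pi> t i) a) * ennreal (exit_rate q i a)) * w"
      by (cases "s < t") (auto simp: mult.assoc intro!: mult_left_mono)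
  qed
  also have "\<dots> = w"
    by (simp only: nn_integral_multc[OF survival_times_actions_measurable[OF pol s]]
        policy_kernel_outside_target(2)[OF pol i s f] mult_1)
  finally show ?thesis .
qed

section \<open>Optimality\<close>

lemma value_iterate_le_hit_within:
  assumes pol: "\<pi> \<in> markov_policies A" and s: "0 \<le> s"
  shows "value_iterate n i \<le> jump_rates.hit_within (positive_time_rate \<pi>) B n (ennreal s, i)"
  using s
proof (induction n arbitrary: s i)
  interpret jump_rates "positive_time_rate \<pi>" "max_exit_rate A q"
    by (rule jump_rates_policy[OF pol])
  {
    case 0
    show ?case by simp
  next
    case (Suc n)
    show ?case
    proof (cases "i \<in> B")
      case False
      have "value_iterate (Suc n) i \<le> (\<integral>\<^sup>+ y. hit_within B n y \<partial>policy_kernel \<pi> (ennreal s, i))"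
      proof (rule policy_kernel_ge[OF pol False Suc.prems hit_within_measurable])
        fix t :: real and a assume "0 \<le> t" "a \<in> A i"
        have "value_iterate (Suc n) i \<le> lookahead (value_iterate n) i a"
          using False Min_lookahead_le[OF \<open>a \<in> A i\<close>] by simp
        also have "\<dots> \<le> lookahead (\<lambda>j. hit_within B n (ennreal t, j)) i a"
          by (rule lookahead_mono) (rule Suc.IH[OF \<open>0 \<le> t\<close>])
        finally show "value_iterate (Suc n) i \<le> lookahead (\<lambda>j. hit_within B n (ennreal t, j)) i a" .
      qed
      with False show ?thesis by simp
    qed (simp add: hit_within_target)
  }
qed

text \<open>
  The induction uses the fixed bound \<open>optimal_value\<close> rather than the iterates: the policy is chosen
  for the limit and need not be optimal for any finite number of jumps.
\<close>

lemma hit_within_le_optimal_value: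
  assumes pol: "stationary_policy f \<in> markov_policies A"
    and f: "\<And>i. i \<notin> B \<Longrightarrow> lookahead optimal_value i (f i) = optimal_value i"
    and s: "0 \<le> s"
  shows "jump_rates.hit_within (positive_time_rate (stationary_policy f)) B n (ennreal s, i) \<le> optimal_value i"
  using s
proof (induction n arbitrary: s i)
  interpret jump_rates "positive_time_rate (stationary_policy f)" "max_exit_rate A q"
    by (rule jump_rates_policy[OF pol])
  {
    case 0
    show ?case by (auto simp: indicator_def optimal_value_target)
  next
    case (Suc n)
    show ?case
    proof (cases "i \<in> B")
      case False
      have "(\<integral>\<^sup>+ y. hit_within B n y \<partial>policy_kernel (stationary_policy f) (ennreal s, i)) \<le> optimal_value i"
      proof (rule policy_kernel_le[OF pol False Suc.prems hit_within_measurable])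
        fix t :: real and a assume t: "0 \<le> t" and "a \<in> set_pmf (stationary_policy f t i)"
        then have "a = f i" by (simp add: stationary_policy_def)
        have "lookahead (\<lambda>j. hit_within B n (ennreal t, j)) i a \<le> lookahead optimal_value i a"
          by (rule lookahead_mono) (rule Suc.IH[OF t])
        then show "lookahead (\<lambda>j. hit_within B n (ennreal t, j)) i a \<le> optimal_value i"
          by (simp add: f[OF False] \<open>a = f i\<close>)
      qed
      with False show ?thesis by simp
    qed (simp add: optimal_value_target)
  }
qed

lemma hit_prob_eq_SUP_hit_within:
  assumes "\<pi> \<in> markov_policies A"
  shows "hit_prob B A q \<pi> i = enn2real (SUP n. jump_rates.hit_within (positive_time_rate \<pi>) B n (0, i))"
proof -
  interpret jump_rates "positive_time_rate \<pi>" "max_exit_rate A q"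
    by (rule jump_rates_policy[OF assms])
  have "jump_law (policy_rate A q \<pi>) = jump_law (positive_time_rate \<pi>)"
    by (rule jump_law_cong) (simp add: positive_time_rate_def)
  then show ?thesis
    unfolding hit_prob_def policy_law_def by (simp only: hit_probability_jump_law)
qed

lemma optimal_value_le_hit_prob:
  assumes "\<pi> \<in> markov_policies A"
  shows "enn2real (optimal_value i) \<le> hit_prob B A q \<pi> i"
proof -
  interpret jump_rates "positive_time_rate \<pi>" "max_exit_rate A q"
    by (rule jump_rates_policy[OF assms])
  interpret prob_space "jump_law (positive_time_rate \<pi>) i" by (rule prob_space_jump_law)
  have "optimal_value i \<le> (SUP n. hit_within B n (0, i))"
    unfolding optimal_value_def
    using value_iterate_le_hit_within[OF assms order_refl] by (intro SUP_mono) auto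
  moreover have "(SUP n. hit_within B n (0, i)) \<le> 1"
    unfolding emeasure_hit_prefix[symmetric] by (intro SUP_least emeasure_le_1)
  ultimately show ?thesis
    unfolding hit_prob_eq_SUP_hit_within[OF assms] by (intro enn2real_mono) (auto simp: le_less_trans)
qed

lemma stationary_policy_markov:
  "f \<in> decision_functions A \<Longrightarrow> stationary_policy f \<in> markov_policies A"
  by (auto simp: markov_policies_def decision_functions_def stationary_policy_def)

lemma hit_prob_stationary_le_optimal_value:
  assumes "f \<in> decision_functions A"
    and "\<And>i. i \<notin> B \<Longrightarrow> lookahead optimal_value i (f i) = optimal_value i"
  shows "hit_prob B A q (stationary_policy f) i \<le> enn2real (optimal_value i)"
proof -
  note pol = stationary_policy_markov[OF assms(1)]
  have "(SUP n. jump_rates.hit_within (positive_time_rate (stationary_policy f)) B n (0, i)) \<le> optimal_value i"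
    using hit_within_le_optimal_value[OF pol assms(2) order_refl] by (intro SUP_least) simp
  then show ?thesis
    unfolding hit_prob_eq_SUP_hit_within[OF pol]
    using optimal_value_le_1[of i] by (intro enn2real_mono) (auto simp: le_less_trans)
qed

lemma optimal_decision_function_exists:
  "\<exists>f\<in>decision_functions A. \<forall>i\<in>-B. lookahead optimal_value i (f i) = optimal_value i"
proof -
  have "\<exists>a. a \<in> A i \<and> (i \<notin> B \<longrightarrow> lookahead optimal_value i a = optimal_value i)" for i
    using optimal_action_exists[of i] actions_nonempty[of i] by blast
  then obtain f where "\<And>i. f i \<in> A i" "\<And>i. i \<notin> B \<Longrightarrow> lookahead optimal_value i (f i) = optimal_value i"
    by metis
  then show ?thesis by (auto simp: decision_functions_def)
qed

lemma min_hit_prob_eq_optimal_value: "min_hit_prob B A q i = enn2real (optimal_value i)"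
proof -
  obtain f where f: "f \<in> decision_functions A"
      "\<And>i. i \<notin> B \<Longrightarrow> lookahead optimal_value i (f i) = optimal_value i"
    using optimal_decision_function_exists by auto
  note pol = stationary_policy_markov[OF f(1)]
  have "hit_prob B A q (stationary_policy f) i = enn2real (optimal_value i)"
    by (intro antisym hit_prob_stationary_le_optimal_value[OF f] optimal_value_le_hit_prob[OF pol])
  with pol show ?thesis
    unfolding min_hit_prob_def
    by (intro cInf_eq_minimum) (auto intro: optimal_value_le_hit_prob rev_image_eqI)
qed

lemma one_step_value_min_hit_prob:
  assumes "i \<notin> B" "a \<in> A i"
  shows "one_step_value B q (min_hit_prob B A q) i a = enn2real (lookahead optimal_value i a)"
  using one_step_value_eq_lookahead[OF assms] by (simp add: min_hit_prob_eq_optimal_value[abs_def])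

lemma min_hit_prob_le_one_step_value:
  assumes "i \<notin> B" "a \<in> A i"
  shows "min_hit_prob B A q i \<le> one_step_value B q (min_hit_prob B A q) i a"
  unfolding one_step_value_min_hit_prob[OF assms] min_hit_prob_eq_optimal_value
  using optimal_value_le_lookahead[OF assms] lookahead_le_1[OF assms, of optimal_value] optimal_value_le_1
  by (intro enn2real_mono) (auto simp: le_less_trans)

end

text \<open>
  The decision function is one that attains the optimal value in the extended reals; it then
  attains the minimum of the real one-step values, which gives the optimality equation and the
  optimality of the policy together.
\<close>

theorem theorem3p1:
  fixes B :: "'s::countable set"
    and A :: "'s \<Rightarrow> 'a set"
    and q :: "'s \<Rightarrow> 's \<Rightarrow> 'a \<Rightarrow> real"
  assumes "controlled_system B A q"
  shows "(\<forall>i\<in>-B. min_hit_prob B A q i =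
            (MIN a\<in>A i. one_step_value B q (min_hit_prob B A q) i a)) \<and>
         (\<exists>f\<in>decision_functions A.
            (\<forall>i\<in>-B. is_arg_min (one_step_value B q (min_hit_prob B A q) i) (\<lambda>a. a \<in> A i) (f i)) \<and>
            optimal_policy B A q (stationary_policy f))"
proof -
  interpret controlled_system B A q by (rule assms)
  obtain f where f: "f \<in> decision_functions A"
      "\<And>i. i \<notin> B \<Longrightarrow> lookahead optimal_value i (f i) = optimal_value i"
    using optimal_decision_function_exists by auto
  have fA: "f i \<in> A i" for i using f(1) by (simp add: decision_functions_def)
  have attained: "one_step_value B q (min_hit_prob B A q) i (f i) = min_hit_prob B A q i" if "i \<notin> B" for i
    using that by (simp add: one_step_value_min_hit_prob fA f(2) min_hit_prob_eq_optimal_value)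
  have "min_hit_prob B A q i = (MIN a\<in>A i. one_step_value B q (min_hit_prob B A q) i a)" if i: "i \<notin> B" for i
  proof (rule Min_eqI[symmetric])
    show "min_hit_prob B A q i \<in> one_step_value B q (min_hit_prob B A q) i ` A i"
      using attained[OF i] fA[of i] by (metis imageI)
  qed (use min_hit_prob_le_one_step_value[OF i] finite_actions in auto)
  moreover have "is_arg_min (one_step_value B q (min_hit_prob B A q) i) (\<lambda>a. a \<in> A i) (f i)" if i: "i \<notin> B" for i
    unfolding is_arg_min_def attained[OF i]
    using fA min_hit_prob_le_one_step_value[OF i] by (auto simp: not_less)
  moreover have "optimal_policy B A q (stationary_policy f)"
    unfolding optimal_policy_def min_hit_prob_eq_optimal_value
    using stationary_policy_markov[OF f(1)] hit_prob_stationary_le_optimal_value[OF f]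
    by (auto intro!: antisym optimal_value_le_hit_prob)
  ultimately show ?thesis using f(1) by auto
qed

end
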